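(* For the Polish group $\mathbb{Z}^\omega$, the cardinal invariants of the $\sigma$-ideal $\mathcal{HN}(\mathbb{Z}^\omega)$ of Haar null subsets of $\mathbb{Z}^\omega$ satisfy (in ZFC): \[ \begin{array}{lll} \mathrm{add}(\mathcal{HN}(\mathbb{Z}^\omega)) &=& \omega_1,\\ \mathrm{cov}(\mathcal{HN}(\mathbb{Z}^\omega)) &=& \min\{\mathfrak{b}, \mathrm{cov}(\mathcal{N})\},\\ \mathrm{non}(\mathcal{HN}(\mathbb{Z}^\omega)) &=& \max\{\mathfrak{d}, \mathrm{non}(\mathcal{N})\},\\ \mathrm{cof}(\mathcal{HN}(\mathbb{Z}^\omega)) &=& \mathfrak{c}. \end{array} \]
   Context: A subset $X$ of a Polish group $G$ is Haar null if there exist a Borel probability measure $\mu$ on $G$ and a Borel set $B \subset G$ containing $X$ such that $\mu(gBh)=0$ for every $g,h\in G$; $\mathcal{HN}(G)$ denotes the family of Haar null subsets of $G$ (it is a proper $\sigma$-ideal for non-locally compact $G$ such as $\mathbb{Z}^\omega$). The group $\mathbb{Z}^\omega$ carries the product topology of the discrete topologies and coordinatewise addition. For a $\sigma$-ideal $\mathcal{I}$ on a set $X$: $\mathrm{add}(\mathcal{I})=\min\{|\mathcal{A}|:\mathcal{A}\subset\mathcal{I},\ \bigcup\mathcal{A}\notin\mathcal{I}\}$; $\mathrm{cov}(\mathcal{I})=\min\{|\mathcal{A}|:\mathcal{A}\subset\mathcal{I},\ \bigcup\mathcal{A}=X\}$; $\mathrm{non}(\mathcal{I})=\min\{|H|:H\subset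 X,\ H\notin\mathcal{I}\}$; $\mathrm{cof}(\mathcal{I})=\min\{|\mathcal{A}|:\mathcal{A}\subset\mathcal{I},\ \forall I\in\mathcal{I}\ \exists A\in\mathcal{A}\ I\subset A\}$. $\mathcal{N}$ is the $\sigma$-ideal of Lebesgue null subsets of $\mathbb{R}$; $\mathfrak{b}$ and $\mathfrak{d}$ are the bounding and dominating numbers (least size of an unbounded, respectively dominating, family in $\omega^\omega$ under eventual domination); $\mathfrak{c}=2^{\aleph_0}$. *)

theory Defs
  imports "HOL-Probability.Probability" "HOL-Library.Function_Algebras"
begin

unbundle cardinal_syntax

(* clashes with the notation for equality of cardinals *)
no_notation elt_set_eq (infix \<open>=o\<close> 50)

section \<open>The Polish group \<open>nat \<Rightarrow> int\<close>\<close>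

text \<open>
  The library equips \<^typ>\<open>int\<close> with the discrete topology and function types with the product
  topology and with pointwise addition. The instances below establish that these make
  \<open>nat \<Rightarrow> int\<close> a Polish group. The metric added to \<^typ>\<open>int\<close> induces the topology it already has.
\<close>

instantiation int :: metric_space
begin

definition dist_int_def: "dist m n = \<bar>real_of_int (m - n)\<bar>"

definition uniformity_int_def:
  "(uniformity :: (int \<times> int) filter) = (INF e\<in>{0<..}. principal {(x, y). dist x y < e})"

instance
proof
  fix U :: "int set"
  have unif: "eventually P uniformity \<longleftrightarrow> (\<exists>e>0. \<forall>x y. dist x y < e \<longrightarrow> P (x, y))"
    for P :: "int \<times> int \<Rightarrow> bool"
    unfolding uniformity_int_def
    by (subst eventually_INF_base)
       (auto simp: eventually_principal subset_eq intro: bexI[of _ "min _ _"])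
  have "\<forall>x\<in>U. eventually (\<lambda>(x', y). x' = x \<longrightarrow> y \<in> U) uniformity"
  proof
    fix x assume "x \<in> U"
    moreover have "a = b" if "dist a b < 1" for a b :: int
      using that unfolding dist_int_def by linarith
    ultimately show "eventually (\<lambda>(x', y). x' = x \<longrightarrow> y \<in> U) uniformity"
      unfolding unif by (intro exI[of _ 1]) auto
  qed
  then show "open U \<longleftrightarrow> (\<forall>x\<in>U. eventually (\<lambda>(x', y). x' = x \<longrightarrow> y \<in> U) uniformity)"
    using Topological_Spaces.open_discrete[of U] by blast
qed (auto simp: dist_int_def uniformity_int_def)

end

instance int :: polish_space
proof
  fix X :: "nat \<Rightarrow> int"
  assume "Cauchy X"
  then obtain M where M: "\<And>m n. m \<ge> M \<Longrightarrow> n \<ge> M \<Longrightarrow> dist (X m) (X n) < 1"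
    unfolding Cauchy_def by (meson zero_less_one)
  have "X n = X M" if "n \<ge> M" for n
    using M[OF that order_refl] by (simp add: dist_int_def)
  then have "\<forall>\<^sub>F n in sequentially. X n = X M"
    unfolding eventually_sequentially by blast
  then show "convergent X"
    unfolding convergent_def by (intro exI[of _ "X M"] tendsto_eventually)
next
  let ?B = "range (\<lambda>n::int. {n})"
  show "\<exists>B::int set set. countable B \<and> open = generate_topology B"
  proof (intro exI conjI ext)
    show "countable ?B" by simp
    fix S :: "int set"
    have "generate_topology ?B (\<Union>x\<in>S. {x})"
      by (rule generate_topology.UN) (auto intro: generate_topology.Basis)
    then show "open S = generate_topology ?B S"
      by (simp add: Topological_Spaces.open_discrete)
  qed
qed

instance int :: topological_group_add
  by standard (simp add: nhds_discrete filterlim_principal eventually_principal)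

instance "fun" :: (type, topological_monoid_add) topological_monoid_add
proof
  fix a b :: "'a \<Rightarrow> 'b"
  have "continuous_on UNIV (\<lambda>x :: ('a \<Rightarrow> 'b) \<times> ('a \<Rightarrow> 'b). \<lambda>i. fst x i + snd x i)"
  proof (rule continuous_on_coordinatewise_then_product)
    fix i
    have "continuous_on UNIV (\<lambda>x :: ('a \<Rightarrow> 'b) \<times> ('a \<Rightarrow> 'b). fst x i)"
      by (rule continuous_on_product_then_coordinatewise[OF continuous_on_fst[OF continuous_on_id]])
    moreover have "continuous_on UNIV (\<lambda>x :: ('a \<Rightarrow> 'b) \<times> ('a \<Rightarrow> 'b). snd x i)"
      by (rule continuous_on_product_then_coordinatewise[OF continuous_on_snd[OF continuous_on_id]])
    ultimately show "continuous_on UNIV (\<lambda>x :: ('a \<Rightarrow> 'b) \<times> ('a \<Rightarrow> 'b). fst x i + snd x i)"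
      by (rule continuous_on_add)
  qed
  then have "((\<lambda>x :: ('a \<Rightarrow> 'b) \<times> ('a \<Rightarrow> 'b). fst x + snd x) \<longlongrightarrow> fst (a, b) + snd (a, b)) (at (a, b))"
    unfolding plus_fun_def continuous_on_def by blast
  then show "LIM x (nhds a \<times>\<^sub>F nhds b). fst x + snd x :> nhds (a + b)"
    using tendsto_at_iff_tendsto_nhds[of "\<lambda>x. fst x + snd x" "(a, b)"] by (simp add: nhds_prod)
qed

instance "fun" :: (type, topological_group_add) topological_group_add
proof
  fix a :: "'a \<Rightarrow> 'b"
  have "continuous_on UNIV (\<lambda>x :: 'a \<Rightarrow> 'b. \<lambda>i. - x i)"
    by (intro continuous_on_coordinatewise_then_product continuous_on_minus
          continuous_on_product_coordinates)
  then have "(uminus \<longlongrightarrow> - a) (at a)"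
    unfolding fun_Compl_def continuous_on_def by blast
  then show "(uminus \<longlongrightarrow> - a) (nhds a)"
    unfolding tendsto_at_iff_tendsto_nhds .
qed


section \<open>Haar null sets\<close>

text \<open>
  Translates of Borel sets are Borel, so membership in \<^const>\<open>null_sets\<close> just says that the
  translate has measure zero.
\<close>

definition haar_null :: "'a::{polish_space, topological_group_add} set \<Rightarrow> bool" where
  "haar_null X \<longleftrightarrow>
     (\<exists>(\<mu> :: 'a measure) B. prob_space \<mu> \<and> sets \<mu> = sets borel \<and> B \<in> sets borel \<and> X \<subseteq> B \<and>
        (\<forall>g h. (\<lambda>x. g + x + h) ` B \<in> null_sets \<mu>))"

definition HN :: "(nat \<Rightarrow> int) set set" where
  "HN = {X. haar_null X}"


section \<open>Cardinal invariants\<close>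

text \<open>
  Cardinals are cardinal orders in the sense of \<^theory>\<open>HOL.BNF_Cardinal_Order_Relation\<close>, compared
  by \<open>\<le>o\<close> and \<open>=o\<close>. \<open>min_card F\<close> is the least cardinality of a member of \<open>F\<close>; it is only
  meaningful for nonempty \<open>F\<close>.
\<close>

definition min_card :: "'a set set \<Rightarrow> 'a rel" where
  "min_card F = |SOME A. A \<in> F \<and> (\<forall>B\<in>F. |A| \<le>o |B| )|"

lemma min_card:
  assumes "F \<noteq> {}"
  obtains A where "A \<in> F" "min_card F = |A|" "\<And>B. B \<in> F \<Longrightarrow> min_card F \<le>o |B|"
proof -
  have "\<exists>r\<in>card_of ` F. \<forall>r'\<in>card_of ` F. r \<le>o r'"
    using assms by (intro exists_minim_Card_order) (auto simp: card_of_Card_order)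
  then have "\<exists>A. A \<in> F \<and> (\<forall>B\<in>F. |A| \<le>o |B| )"
    by auto
  from someI_ex[OF this] show ?thesis
    by (intro that[of "SOME A. A \<in> F \<and> (\<forall>B\<in>F. |A| \<le>o |B| )"]) (auto simp: min_card_def)
qed

text \<open>
  Minimum and maximum of two cardinals, which may live on different types.
\<close>

definition cmin :: "'a rel \<Rightarrow> 'b rel \<Rightarrow> ('a + 'b) rel" where
  "cmin r s = (if r \<le>o s then |Inl ` Field r| else |Inr ` Field s| )"

definition cmax :: "'a rel \<Rightarrow> 'b rel \<Rightarrow> ('a + 'b) rel" where
  "cmax r s = (if r \<le>o s then |Inr ` Field s| else |Inl ` Field r| )"

lemma card_of_inj_image_Field:
  assumes "Card_order r" "inj f"
  shows "|f ` Field r| =o r"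
proof -
  have "bij_betw f (Field r) (f ` Field r)"
    using assms(2) by (auto simp: bij_betw_def intro: inj_on_subset)
  then have "|f ` Field r| =o |Field r|"
    using card_of_ordIso ordIso_symmetric by blast
  then show ?thesis
    using card_of_Field_ordIso[OF assms(1)] ordIso_transitive by blast
qed

lemma cmin_cmax:
  assumes "Card_order r" "Card_order s"
  shows "r \<le>o s \<Longrightarrow> cmin r s =o r" "\<not> r \<le>o s \<Longrightarrow> cmin r s =o s"
    and "r \<le>o s \<Longrightarrow> cmax r s =o s" "\<not> r \<le>o s \<Longrightarrow> cmax r s =o r"
  using assms by (simp_all add: cmin_def cmax_def card_of_inj_image_Field)

text \<open>Invariants of a \<open>\<sigma>\<close>-ideal \<open>I\<close> on the set of all elements of a type.\<close>

definition add_ideal :: "'a set set \<Rightarrow> 'a set rel" where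
  "add_ideal I = min_card {\<A>. \<A> \<subseteq> I \<and> \<Union>\<A> \<notin> I}"

definition cov_ideal :: "'a set set \<Rightarrow> 'a set rel" where
  "cov_ideal I = min_card {\<A>. \<A> \<subseteq> I \<and> \<Union>\<A> = UNIV}"

definition non_ideal :: "'a set set \<Rightarrow> 'a rel" where
  "non_ideal I = min_card {H. H \<notin> I}"

definition cof_ideal :: "'a set set \<Rightarrow> 'a set rel" where
  "cof_ideal I = min_card {\<A>. \<A> \<subseteq> I \<and> (\<forall>J\<in>I. \<exists>A\<in>\<A>. J \<subseteq> A)}"

definition Lebesgue_null :: "real set set" where
  "Lebesgue_null = null_sets lebesgue"

definition eventually_dominated :: "(nat \<Rightarrow> nat) \<Rightarrow> (nat \<Rightarrow> nat) \<Rightarrow> bool" where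
  "eventually_dominated f g \<longleftrightarrow> (\<forall>\<^sub>F n in sequentially. f n \<le> g n)"

definition bounding_number :: "(nat \<Rightarrow> nat) rel" where
  "bounding_number = min_card {F. \<not> (\<exists>g. \<forall>f\<in>F. eventually_dominated f g)}"

definition dominating_number :: "(nat \<Rightarrow> nat) rel" where
  "dominating_number = min_card {F. \<forall>g. \<exists>f\<in>F. eventually_dominated g f}"

definition omega_1 :: "nat set rel" where
  "omega_1 = cardSuc natLeq"

definition continuum :: "(nat \<Rightarrow> bool) rel" where
  "continuum = ctwo ^c natLeq"

end

theory Submission
  imports Defs "HOL-Library.Sublist"
begin

text \<open>
  Uniform measures on boxes \<open>\<Prod>n. {0..<h n}\<close>, realised by mixed radix expansions of the reals in
  \<open>[0,1)\<close>, are universal witnesses: every Haar null set is killed by all of them whose side lengths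
  \<open>h\<close> eventually dominate some \<open>h0\<close>. This transfers null sets between \<open>nat \<Rightarrow> int\<close> and the real
  line and yields the covering number and the uniformity.

  For the other two invariants, split \<open>nat \<Rightarrow> int\<close> into the orthants given by sign patterns \<open>x\<close>. No
  orthant is contained in a Haar null set, but the graph of a Borel map choosing one point of each
  orthant is Haar null. A sign pattern can code a tree projecting to the complement of a Borel set
  \<open>B\<close> (every Borel set is analytic). Pruning this tree \<open>\<xi>\<close> times, for \<open>\<xi> < \<omega>\<^sub>1\<close>, and taking the
  leftmost branch gives \<open>\<omega>\<^sub>1\<close> Borel maps, and the union of their graphs has no Borel Haar null hull.
  A sign pattern can also code a labelling of finite sequences; reading the labels along
  \<open>z\<close> gives a family of continuum many graphs. Those contained in a given Borel Haar null set
  correspond to a coanalytic set of parameters without perfect subsets, hence to at most \<open>\<omega>\<^sub>1\<close>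
  parameters.
\<close>

text \<open>Box measures arise by convolution. A witness gives positive mass to some box, so by
  Fubini a uniform measure on a slightly wider box, shifted by a suitable point of that box, kills
  the hull. If the sides grow fast enough, the widening costs only a convergent product of density
  ratios. Hence fewer than the bounding number of Haar null sets share one witness. The obstacle for
  the additivity is that hulls must be Borel: no single Borel map turns every code of a hull
  \<open>B\<close> into a point outside \<open>B\<close>, for its graph would itself have a Borel
  Haar null hull. But pruning a tree on a countable set stops at some countable stage, and each
  stage depends on the tree in a Borel way; so every code is handled by one of
  \<open>\<omega>\<^sub>1\<close> Borel maps. The diagonal argument works because the code is the
  sign pattern, which every point of the orthant displays. For the cofinality, the additivity
  argument already makes a cofinal family uncountable, so its size absorbs the
  \<open>\<omega>\<^sub>1\<close> graphs that one member may contain; no assumption on the continuum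
  enters.\<close>

abbreviation seg :: "(nat \<Rightarrow> 'a) \<Rightarrow> nat \<Rightarrow> 'a list" where
  "seg v n \<equiv> map v [0..<n]"

lemma take_seg: "j \<le> n \<Longrightarrow> take j (seg v n) = seg v j"
  by (simp add: take_map)

lemma seg_eq_iff: "seg v n = seg w n \<longleftrightarrow> (\<forall>i<n. v i = w i)"
  by (auto simp: list_eq_iff_nth_eq)

lemma seg_Suc_eq_Cons: "seg v (Suc n) = v 0 # seg (\<lambda>i. v (Suc i)) n"
  by (rule nth_equalityI) (auto simp: nth_Cons' simp del: upt_Suc)

section \<open>The first uncountable ordinal\<close>

text \<open>Elements of the field of \<open>omega_1\<close> stand in for the countable ordinals.
  Sets of naturals outside the field have no predecessors under \<open>lt1\<close>.\<close>

definition lt1 :: "nat set \<Rightarrow> nat set \<Rightarrow> bool" where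
  "lt1 \<xi> \<eta> \<longleftrightarrow> (\<xi>, \<eta>) \<in> omega_1 \<and> \<xi> \<noteq> \<eta>"

lemma Card_order_omega_1: "Card_order omega_1"
  unfolding omega_1_def by (rule cardSuc_Card_order[OF natLeq_Card_order])

lemma Well_order_omega_1: "Well_order omega_1"
  using Card_order_omega_1 by (simp add: card_order_on_def)

lemma countable_iff_ordLeq_natLeq: "countable A \<longleftrightarrow> |A| \<le>o natLeq"
proof -
  have "countable A \<longleftrightarrow> |A| \<le>o |UNIV :: nat set|"
    unfolding countable_def card_of_ordLeq[symmetric] by simp
  then show ?thesis
    using card_of_nat ordIso_symmetric ordLeq_ordIso_trans by blast
qed

lemma countable_iff_ordLess_omega_1: "countable A \<longleftrightarrow> |A| <o omega_1"
  unfolding omega_1_def countable_iff_ordLeq_natLeq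
  by (simp add: cardSuc_ordLeq_ordLess card_of_Card_order natLeq_Card_order)

lemma uncountable_Field_omega_1: "uncountable (Field omega_1)"
  using countable_iff_ordLess_omega_1 card_of_Field_ordIso[OF Card_order_omega_1]
  by (meson not_ordLess_ordIso)

lemma lt1_trans: "lt1 \<xi> \<eta> \<Longrightarrow> lt1 \<eta> \<zeta> \<Longrightarrow> lt1 \<xi> \<zeta>"
proof -
  have "trans omega_1" "antisym omega_1"
    using Well_order_omega_1 unfolding order_on_defs by blast+
  then show "lt1 \<xi> \<eta> \<Longrightarrow> lt1 \<eta> \<zeta> \<Longrightarrow> lt1 \<xi> \<zeta>"
    unfolding lt1_def trans_def antisym_def by blast
qed

lemma wf_lt1: "wf {(\<xi>, \<eta>). lt1 \<xi> \<eta>}"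
proof -
  have "{(\<xi>, \<eta>). lt1 \<xi> \<eta>} = omega_1 - Id"
    by (auto simp: lt1_def)
  then show ?thesis
    using Well_order_omega_1 by (simp add: well_order_on_def)
qed

lemma lt1_Field: "lt1 \<xi> \<eta> \<Longrightarrow> \<xi> \<in> Field omega_1" "lt1 \<xi> \<eta> \<Longrightarrow> \<eta> \<in> Field omega_1"
  by (auto simp: lt1_def Field_def)

lemma countable_below_lt1: "countable {\<eta>. lt1 \<eta> \<xi>}"
proof (cases "\<xi> \<in> Field omega_1")
  case True
  have "{\<eta>. lt1 \<eta> \<xi>} = underS omega_1 \<xi>"
    by (auto simp: lt1_def underS_def)
  then show ?thesis
    using card_of_underS[OF Card_order_omega_1 True] countable_iff_ordLess_omega_1 by metis
next
  case False
  then have "{\<eta>. lt1 \<eta> \<xi>} = {}"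
    using lt1_Field by blast
  then show ?thesis by simp
qed

text \<open>Regularity of \<open>omega_1\<close>: countably many countable initial segments cannot
  exhaust an uncountable field, and by totality an element outside them lies above all of
  them.\<close>

lemma ex_lt1_bound:
  assumes "countable C"
  obtains \<xi> where "\<xi> \<in> Field omega_1" "\<And>\<eta>. \<eta> \<in> C \<Longrightarrow> \<eta> \<in> Field omega_1 \<Longrightarrow> lt1 \<eta> \<xi>"
proof -
  have "countable (\<Union>\<eta>\<in>C. insert \<eta> {\<zeta>. lt1 \<zeta> \<eta>})"
    using assms countable_below_lt1 by auto
  then obtain \<xi> where \<xi>: "\<xi> \<in> Field omega_1" "\<xi> \<notin> (\<Union>\<eta>\<in>C. insert \<eta> {\<zeta>. lt1 \<zeta> \<eta>})"
    using uncountable_Field_omega_1 by (meson countable_subset subsetI)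
  have "lt1 \<eta> \<xi>" if "\<eta> \<in> C" "\<eta> \<in> Field omega_1" for \<eta>
  proof -
    have "(\<eta>, \<xi>) \<in> omega_1 \<or> (\<xi>, \<eta>) \<in> omega_1" if "\<eta> \<noteq> \<xi>"
      using Well_order_omega_1 \<xi>(1) \<open>\<eta> \<in> Field omega_1\<close> that
      unfolding order_on_defs total_on_def by blast
    then show ?thesis
      using \<xi>(2) \<open>\<eta> \<in> C\<close> unfolding lt1_def by blast
  qed
  then show ?thesis using \<xi> that by blast
qed

section \<open>Pruning trees\<close>

text \<open>A node survives stage \<open>\<xi>\<close> when its rank in the tree is at least
  \<open>\<xi>\<close>. Quantifying over all earlier stages treats zero, successor and limit stages
  in one clause.\<close>

function prune :: "('a list \<Rightarrow> bool) \<Rightarrow> nat set \<Rightarrow> 'a list \<Rightarrow> bool" where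
  "prune T \<xi> t \<longleftrightarrow> T t \<and> (\<forall>\<eta>. lt1 \<eta> \<xi> \<longrightarrow> (\<exists>a. prune T \<eta> (t @ [a])))"
  by auto
termination
  by (relation "inv_image {(\<xi>, \<eta>). lt1 \<xi> \<eta>} (\<lambda>(T, \<xi>, t). \<xi>)") (auto intro: wf_inv_image wf_lt1)

declare prune.simps [simp del]

lemma prune_mono: "lt1 \<eta> \<xi> \<Longrightarrow> prune T \<xi> t \<Longrightarrow> prune T \<eta> t"
  using lt1_trans by (subst (asm) prune.simps, subst prune.simps) blast

lemma prune_imp: "prune T \<xi> t \<Longrightarrow> T t"
  by (subst (asm) prune.simps) blast

lemma prune_branch:
  assumes "\<And>n. T (seg b n)"
  shows "prune T \<xi> (seg b n)"
proof (induction \<xi> arbitrary: n rule: wf_induct_rule[OF wf_lt1])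
  case (1 \<xi>)
  have "\<exists>a. prune T \<eta> (seg b n @ [a])" if "lt1 \<eta> \<xi>" for \<eta>
    using 1[of \<eta> "Suc n"] that by auto
  then show ?case
    using assms by (subst prune.simps) blast
qed

text \<open>There are only countably many nodes, so the stages at which nodes disappear have a bound
  below \<open>omega_1\<close>; from there on nothing disappears, and every survivor has a surviving
  child.\<close>

lemma prune_stable:
  fixes T :: "'a::countable list \<Rightarrow> bool"
  obtains \<xi> where "\<xi> \<in> Field omega_1"
    "\<And>t. prune T \<xi> t \<Longrightarrow> \<exists>a. prune T \<xi> (t @ [a])"
proof -
  \<comment> \<open>Any stage at which \<open>t\<close> is gone will do, by
    \<open>prune_mono\<close>. For a node that never disappears the value is arbitrary, hence the
    restriction to \<open>Field omega_1\<close> in the bound.\<close>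
  define leave where "leave t = (SOME \<eta>. \<eta> \<in> Field omega_1 \<and> \<not> prune T \<eta> t)" for t
  obtain \<xi> where \<xi>: "\<xi> \<in> Field omega_1"
    "\<And>\<eta>. \<eta> \<in> range leave \<Longrightarrow> \<eta> \<in> Field omega_1 \<Longrightarrow> lt1 \<eta> \<xi>"
    using ex_lt1_bound[of "range leave"] by auto
  obtain \<xi>' where \<xi>': "lt1 \<xi> \<xi>'"
    using ex_lt1_bound[of "{\<xi>}"] \<xi>(1) by auto
  have stable: "prune T \<eta> t" if "\<eta> \<in> Field omega_1" "prune T \<xi> t" for \<eta> t
  proof (rule ccontr)
    assume "\<not> prune T \<eta> t"
    with that(1) have "leave t \<in> Field omega_1 \<and> \<not> prune T (leave t) t"
      unfolding leave_def by (rule_tac someI_ex) blast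
    then show False
      using \<xi>(2) prune_mono that(2) by blast
  qed
  moreover have "\<exists>a. prune T \<xi> (t @ [a])" if "prune T \<xi> t" for t
    using stable[OF lt1_Field(2)[OF \<xi>'] that] \<xi>' by (subst (asm) prune.simps) blast
  ultimately show ?thesis
    using that \<xi>(1) by blast
qed

lemma branch_of_pruned:
  assumes "P []" "\<And>t. P t \<Longrightarrow> \<exists>a. P (t @ [a])"
  obtains b where "\<And>n. P (seg b n)"
proof -
  define node where "node = rec_nat [] (\<lambda>_ t. t @ [SOME a. P (t @ [a])])"
  have node_simps: "node 0 = []" "node (Suc n) = node n @ [SOME a. P (node n @ [a])]" for n
    by (simp_all add: node_def)
  have "P (node n)" for n
  proof (induction n)
    case (Suc n)
    then show ?case
      using someI_ex[OF assms(2)] by (simp add: node_simps(2))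
  qed (simp add: node_simps(1) assms(1))
  moreover have "node = seg (\<lambda>n. SOME a. P (node n @ [a]))"
    by (rule ext, induct_tac n) (simp_all only: node_simps upt_Suc_append le0 map_append list.map upt_0)
  ultimately show ?thesis
    using that by metis
qed

text \<open>Having a branch is only an analytic condition on \<open>T\<close>; here it becomes an
  intersection of \<open>\<omega>\<^sub>1\<close> conditions, each Borel by
  \<open>measurable_prune\<close>.\<close>

lemma prune_root:
  fixes T :: "'a::countable list \<Rightarrow> bool"
  shows "(\<exists>b. \<forall>n. T (seg b n)) \<longleftrightarrow> (\<forall>\<xi>\<in>Field omega_1. prune T \<xi> [])"
proof
  assume "\<exists>b. \<forall>n. T (seg b n)"
  then obtain b where "\<And>n. T (seg b n)" by blast
  then show "\<forall>\<xi>\<in>Field omega_1. prune T \<xi> []"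
    using prune_branch[of T b _ 0] by simp
next
  assume *: "\<forall>\<xi>\<in>Field omega_1. prune T \<xi> []"
  obtain \<xi> where "\<xi> \<in> Field omega_1" "\<And>t. prune T \<xi> t \<Longrightarrow> \<exists>a. prune T \<xi> (t @ [a])"
    by (rule prune_stable[of T]) blast
  with * obtain b where "\<And>n. prune T \<xi> (seg b n)"
    using branch_of_pruned[of "prune T \<xi>"] by blast
  then show "\<exists>b. \<forall>n. T (seg b n)"
    using prune_imp by blast
qed

text \<open>Each stage has only countably many predecessors, so the quantifier over earlier stages
  is a countable conjunction and Borel sets suffice.\<close>

lemma measurable_prune:
  fixes T :: "'p \<Rightarrow> 'a::countable list \<Rightarrow> bool"
  assumes [measurable]: "\<And>t. Measurable.pred M (\<lambda>p. T p t)"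
  shows "Measurable.pred M (\<lambda>p. prune (T p) \<xi> t)"
proof (induction \<xi> arbitrary: t rule: wf_induct_rule[OF wf_lt1])
  case (1 \<xi>)
  have IH: "Measurable.pred M (\<lambda>p. prune (T p) \<eta> t)" if "\<eta> \<in> {\<eta>. lt1 \<eta> \<xi>}" for \<eta> t
    by (rule 1) (use that in simp)
  have "Measurable.pred M (\<lambda>p. \<forall>\<eta>\<in>{\<eta>. lt1 \<eta> \<xi>}. \<exists>a. prune (T p) \<eta> (t @ [a]))"
  proof (cases "{\<eta>. lt1 \<eta> \<xi>} = {}")
    case False
    have [measurable]: "Measurable.pred M (\<lambda>p. prune (T p) (from_nat_into {\<eta>. lt1 \<eta> \<xi>} n) t)" for n t
      by (rule IH) (rule from_nat_into[OF False])
    have "(\<forall>\<eta>\<in>{\<eta>. lt1 \<eta> \<xi>}. R \<eta>) \<longleftrightarrow> (\<forall>n. R (from_nat_into {\<eta>. lt1 \<eta> \<xi>} n))" for R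
      by (metis False countable_below_lt1 from_nat_into from_nat_into_surj)
    then show ?thesis by simp
  qed simp
  then have "Measurable.pred M (\<lambda>p. T p t \<and> (\<forall>\<eta>\<in>{\<eta>. lt1 \<eta> \<xi>}. \<exists>a. prune (T p) \<eta> (t @ [a])))"
    by measurable
  then show ?case
    by (subst prune.simps) simp
qed

section \<open>Borel subsets of the Baire space as projections of trees\<close>

lemma measurable_nat_int_iff:
  "(f \<in> borel_measurable M) \<longleftrightarrow> (\<forall>i. (\<lambda>p. f p i) \<in> measurable M (count_space UNIV))"
  for f :: "'p \<Rightarrow> nat \<Rightarrow> int"
proof -
  have b: "sets (borel :: int measure) = sets (count_space UNIV)"
    by (auto intro!: borel_open Topological_Spaces.open_discrete)
  have "f \<in> borel_measurable M \<longleftrightarrow> f \<in> measurable M (Pi\<^sub>M UNIV (\<lambda>_. borel))"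
    using measurable_cong_sets[OF refl sets_PiM_equal_borel[where ?'a = nat and ?'b = int]] by blast
  also have "\<dots> \<longleftrightarrow> (\<forall>i. (\<lambda>p. f p i) \<in> borel_measurable M)"
    by (auto intro!: measurable_PiM_single'
        intro: measurable_compose[OF _ measurable_component_singleton[OF UNIV_I]])
  also have "\<dots> \<longleftrightarrow> (\<forall>i. (\<lambda>p. f p i) \<in> measurable M (count_space UNIV))"
    using measurable_cong_sets[OF refl b] by blast
  finally show ?thesis .
qed

lemma measurable_coordinate [measurable]:
  "(\<lambda>v::nat \<Rightarrow> int. v i) \<in> measurable borel (count_space UNIV)"
  using measurable_nat_int_iff[of "\<lambda>v. v" borel] by simp

lemma borel_nat_int_eq_sigma:
  "sets (borel :: (nat \<Rightarrow> int) measure) = sigma_sets UNIV {{v. v i \<in> A} |i A. True}"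
proof -
  have "sets (Pi\<^sub>M UNIV (\<lambda>_::nat. borel :: int measure)) =
     sigma_sets UNIV {{v. v i \<in> A} |i A. True}"
    by (subst sets_PiM_single, rule arg_cong2[where f = sigma_sets])
       (auto simp: borel_open Topological_Spaces.open_discrete)
  then show ?thesis
    by (simp add: sets_PiM_equal_borel)
qed

text \<open>The normal form of an analytic set: \<open>E\<close> is the projection of the closed set
  of pairs all of whose initial segments satisfy \<open>Q\<close>.\<close>

definition projects_to :: "(int list \<Rightarrow> nat list \<Rightarrow> bool) \<Rightarrow> (nat \<Rightarrow> int) set \<Rightarrow> bool" where
  "projects_to Q E \<longleftrightarrow> E = {v. \<exists>w. \<forall>n. Q (seg v n) (seg w n)}"

text \<open>The first entry of the witness names the index \<open>k\<close>, and the remaining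
  entries form a witness for \<open>E k\<close>.\<close>

lemma projects_to_UN:
  fixes E :: "nat \<Rightarrow> (nat \<Rightarrow> int) set"
  assumes "\<And>k. projects_to (Q k) (E k)"
  shows "\<exists>Q'. projects_to Q' (\<Union>k. E k)"
proof -
  \<comment> \<open>Removing the head of \<open>q\<close> leaves one entry fewer, so
    \<open>p\<close> loses its last entry to keep the lengths equal.\<close>
  define Q' where "Q' p q \<longleftrightarrow> q = [] \<or> Q (hd q) (butlast p) (tl q)" for p q
  have Q': "(\<forall>n. Q' (seg v n) (seg w n)) \<longleftrightarrow>
      (\<forall>n. Q (w 0) (seg v n) (seg (\<lambda>i. w (Suc i)) n))" for v w
  proof -
    have "Q' (seg v (Suc n)) (seg w (Suc n)) \<longleftrightarrow> Q (w 0) (seg v n) (seg (\<lambda>i. w (Suc i)) n)" for n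
      unfolding seg_Suc_eq_Cons[of w] Q'_def by simp
    moreover have "Q' (seg v 0) (seg w 0)" by (simp add: Q'_def)
    ultimately show ?thesis by (metis not0_implies_Suc)
  qed
  have "v \<in> (\<Union>k. E k) \<longleftrightarrow> (\<exists>w. \<forall>n. Q' (seg v n) (seg w n))" for v
  proof
    assume "v \<in> (\<Union>k. E k)"
    then obtain k w where "\<forall>n. Q k (seg v n) (seg w n)"
      using assms unfolding projects_to_def by blast
    then show "\<exists>w. \<forall>n. Q' (seg v n) (seg w n)"
      unfolding Q' by (intro exI[of _ "case_nat k w"]) simp
  next
    assume "\<exists>w. \<forall>n. Q' (seg v n) (seg w n)"
    then show "v \<in> (\<Union>k. E k)"
      using assms unfolding projects_to_def Q' by blast
  qed
  then show ?thesis unfolding projects_to_def by blast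
qed

text \<open>One sequence carries a witness for every \<open>k\<close>, interleaved by
  \<open>prod_encode\<close>. A finite segment is tested only where it already contains the entries
  that the test reads.\<close>

lemma projects_to_INT:
  fixes E :: "nat \<Rightarrow> (nat \<Rightarrow> int) set"
  assumes "\<And>k. projects_to (Q k) (E k)"
  shows "\<exists>Q'. projects_to Q' (\<Inter>k. E k)"
proof -
  define Q' where "Q' p q \<longleftrightarrow> (\<forall>k j. j \<le> length p \<and> (\<forall>i<j. prod_encode (k, i) < length q) \<longrightarrow>
      Q k (take j p) (map (\<lambda>i. q ! prod_encode (k, i)) [0..<j]))" for p q
  have Q': "(\<forall>n. Q' (seg v n) (seg w n)) \<longleftrightarrow>
      (\<forall>k n. Q k (seg v n) (seg (\<lambda>i. w (prod_encode (k, i))) n))" (is "?l \<longleftrightarrow> ?r") for v w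
  proof -
    have eq: "Q k (take j (seg v n)) (map (\<lambda>i. seg w n ! prod_encode (k, i)) [0..<j]) =
        Q k (seg v j) (seg (\<lambda>i. w (prod_encode (k, i))) j)"
      if "j \<le> n" "\<forall>i<j. prod_encode (k, i) < n" for k j n
      by (intro arg_cong2[where f = "Q k"]) (use that in \<open>auto simp: take_seg\<close>)
    show ?thesis
    proof
      assume l: ?l
      show ?r
      proof (intro allI)
        fix k j
        \<comment> \<open>The sum exceeds each of its finitely many codes, so a segment of this
          length contains all entries needed for level \<open>j\<close>.\<close>
        define n where "n = j + (\<Sum>i<j. Suc (prod_encode (k, i)))"
        have "prod_encode (k, i) < n" if "i < j" for i
          using member_le_sum[of i "{..<j}" "\<lambda>i. Suc (prod_encode (k, i))"] that
          by (auto simp: n_def)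
        then show "Q k (seg v j) (seg (\<lambda>i. w (prod_encode (k, i))) j)"
          using l[rule_format, of n, unfolded Q'_def] eq[of j n k] by (auto simp: n_def)
      qed
    next
      assume ?r
      then show ?l
        unfolding Q'_def using eq by auto
    qed
  qed
  have "v \<in> (\<Inter>k. E k) \<longleftrightarrow> (\<exists>w. \<forall>n. Q' (seg v n) (seg w n))" for v
  proof
    assume "v \<in> (\<Inter>k. E k)"
    then have "\<forall>k. \<exists>w. \<forall>n. Q k (seg v n) (seg w n)"
      using assms unfolding projects_to_def by blast
    then obtain w where "\<forall>k n. Q k (seg v n) (seg (w k) n)" by metis
    then show "\<exists>w. \<forall>n. Q' (seg v n) (seg w n)"
      unfolding Q' by (intro exI[of _ "\<lambda>m. w (fst (prod_decode m)) (snd (prod_decode m))"]) simp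
  next
    assume "\<exists>w. \<forall>n. Q' (seg v n) (seg w n)"
    then show "v \<in> (\<Inter>k. E k)"
      using assms unfolding projects_to_def Q' by blast
  qed
  then show ?thesis unfolding projects_to_def by blast
qed

lemma projects_to_coordinate: "\<exists>Q. projects_to Q {v. v i \<in> A}"
proof -
  define Q where "Q p q \<longleftrightarrow> (i < length p \<longrightarrow> p ! i \<in> A)" for p :: "int list" and q :: "nat list"
  have "(\<forall>n. Q (seg v n) (seg w n)) \<longleftrightarrow> v i \<in> A" for v w
    unfolding Q_def by (auto dest: spec[of _ "Suc i"])
  then show ?thesis
    unfolding projects_to_def by (intro exI[of _ Q]) auto
qed

text \<open>Analytic sets are not closed under complement, so the induction carries the set and its
  complement together; a countable union on one side is a countable intersection on the
  other.\<close>

lemma borel_projects_to: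
  assumes "E \<in> sets (borel :: (nat \<Rightarrow> int) measure)"
  shows "\<exists>Q. projects_to Q E"
proof -
  have "(\<exists>Q. projects_to Q E) \<and> (\<exists>Q. projects_to Q (- E))"
    using assms unfolding borel_nat_int_eq_sigma
  proof induction
    case (Basic a)
    then obtain i A where a: "a = {v. v i \<in> A}" by blast
    have "- a = {v. v i \<in> - A}" by (auto simp: a)
    then show ?case using projects_to_coordinate a by metis
  next
    case Empty
    show ?case using projects_to_coordinate[of 0 "{}"] projects_to_coordinate[of 0 UNIV] by simp
  next
    case (Compl a)
    then show ?case by (simp add: Compl_eq_Diff_UNIV[symmetric])
  next
    case (Union a)
    then obtain Q Q' where "\<And>k. projects_to (Q k) (a k)" "\<And>k. projects_to (Q' k) (- a k)"
      by metis
    then show ?case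
      using projects_to_UN[of Q a] projects_to_INT[of Q' "\<lambda>k. - a k"] by simp
  qed
  then show ?thesis by blast
qed

section \<open>The number of Borel sets\<close>

lemma continuum_eq: "continuum = |UNIV :: (nat \<Rightarrow> bool) set|"
  by (simp add: continuum_def cexp_def ctwo_def Field_card_of Field_natLeq Func_def)

lemma card_Pow_countable: "|UNIV :: 'a::countable set set| \<le>o continuum"
  unfolding continuum_eq
proof (rule card_of_ordLeqI)
  show "inj_on (\<lambda>A n. \<exists>a\<in>A. n = to_nat a) (UNIV :: 'a set set)"
  proof (rule inj_onI)
    fix A B :: "'a set" assume eq: "(\<lambda>n. \<exists>a\<in>A. n = to_nat a) = (\<lambda>n. \<exists>a\<in>B. n = to_nat a)"
    have "to_nat ` A = {n. \<exists>a\<in>A. n = to_nat a}" "to_nat ` B = {n. \<exists>a\<in>B. n = to_nat a}" by auto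
    then show "A = B"
      using eq by (metis inj_image_eq_iff inj_to_nat)
  qed
qed simp

text \<open>A Borel set is recovered from the relation \<open>Q\<close> projecting to it, and such
  relations are subsets of a countable type.\<close>

lemma card_borel_nat_int: "|sets (borel :: (nat \<Rightarrow> int) measure)| \<le>o continuum"
proof -
  define code where "code E = {(p, q). (SOME Q. projects_to Q E) p q}" for E
  have "{v. \<exists>w. \<forall>n. (seg v n, seg w n) \<in> code E} = E" if "E \<in> sets borel" for E
    using someI_ex[OF borel_projects_to[OF that]] by (simp add: code_def projects_to_def)
  then have "inj_on code (sets borel)"
    by (rule inj_on_inverseI)
  then have "|sets (borel :: (nat \<Rightarrow> int) measure)| \<le>o |UNIV :: (int list \<times> nat list) set set|"
    by (rule card_of_ordLeqI) simp
  then show ?thesis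
    using card_Pow_countable ordLeq_transitive by blast
qed

section \<open>Perfect schemes in uncountable Borel sets\<close>

definition branch_through :: "((int \<times> nat) list \<Rightarrow> bool) \<Rightarrow> (int \<times> nat) list \<Rightarrow> (nat \<Rightarrow> int) set" where
  "branch_through R t = {fst \<circ> b |b. seg b (length t) = t \<and> (\<forall>n. R (seg b n))}"

text \<open>After discarding the countable pieces, two distinct points remain; cutting their
  branches off beyond the first difference gives two uncountable pieces whose first coordinates are
  incompatible.\<close>

lemma uncountable_split:
  assumes "uncountable (branch_through R t)"
  shows "\<exists>t0 t1. uncountable (branch_through R t0) \<and> uncountable (branch_through R t1) \<and>
    strict_prefix t t0 \<and> strict_prefix t t1 \<and>
    (\<forall>v m m'. \<not> (seg v m = map fst t0 \<and> seg v m' = map fst t1))"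
proof -
  \<comment> \<open>A countable union of countable sets. A point outside it has only uncountable
    pieces along each of its branches.\<close>
  define thin where "thin = (\<Union>t'\<in>{t'. countable (branch_through R t')}. branch_through R t')"
  have "countable thin"
    unfolding thin_def by auto
  then have unc: "uncountable (branch_through R t - thin)"
    using assms uncountable_minus_countable by blast
  then obtain v where v: "v \<in> branch_through R t - thin"
    by (metis all_not_in_conv countable_empty)
  moreover obtain v' where v': "v' \<in> branch_through R t - thin" "v' \<noteq> v"
    using unc by (metis countable_empty countable_insert countable_subset insert_iff subsetI)
  ultimately obtain b b' where b: "v = fst \<circ> b" "seg b (length t) = t" "\<And>n. R (seg b n)"
    and b': "v' = fst \<circ> b'" "seg b' (length t) = t" "\<And>n. R (seg b' n)"
    by (auto simp: branch_through_def)
  obtain i where i: "v i \<noteq> v' i" using v'(2) by force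
  \<comment> \<open>Long enough both to extend \<open>t\<close> strictly and to show the difference
    at \<open>i\<close>.\<close>
  define n where "n = Suc (max (length t) i)"
  have unc_seg: "uncountable (branch_through R (seg c n))"
    if "fst \<circ> c \<notin> thin" "\<And>n. R (seg c n)" for c
  proof
    assume "countable (branch_through R (seg c n))"
    moreover have "fst \<circ> c \<in> branch_through R (seg c n)"
      using that(2) by (auto simp: branch_through_def)
    ultimately show False
      using that(1) by (auto simp: thin_def)
  qed
  have pre: "strict_prefix t (seg c n)" if "seg c (length t) = t" for c
  proof (rule strict_prefixI)
    show "prefix t (seg c n)"
      using that take_seg[of "length t" n c] take_is_prefix[of "length t" "seg c n"]
      by (simp add: n_def)
    show "t \<noteq> seg c n"
      by (rule ccontr) (auto dest: arg_cong[of _ _ length] simp: n_def)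
  qed
  have "\<not> (seg u m = map fst (seg b n) \<and> seg u m' = map fst (seg b' n))" for u m m'
  proof
    assume *: "seg u m = map fst (seg b n) \<and> seg u m' = map fst (seg b' n)"
    then have "m = n" "m' = n"
      by (auto dest: arg_cong[of _ _ length])
    then have "seg u n = seg (fst \<circ> b) n" "seg u n = seg (fst \<circ> b') n"
      using * unfolding map_map by blast+
    then have "seg (fst \<circ> b) n = seg (fst \<circ> b') n" by (rule trans[OF sym])
    then have "v i = v' i"
      unfolding seg_eq_iff b(1) b'(1) by (simp add: n_def)
    with i show False ..
  qed
  moreover have "uncountable (branch_through R (seg b n))" "uncountable (branch_through R (seg b' n))"
    using unc_seg[of b] unc_seg[of b'] b(3) b'(3) v v'(1) unfolding b(1) b'(1) by blast+
  ultimately show ?thesis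
    using pre[OF b(2)] pre[OF b'(2)]
    by (intro exI[of _ "seg b n"] exI[of _ "seg b' n"] conjI allI)
qed

text \<open>A copy of the Baire space inside \<open>E\<close>: \<open>e\<close> assigns nodes to
  finite sequences, incompatible ones to different sequences of equal length, and every infinite
  sequence leads to a point of \<open>E\<close>. The splitting runs in the tree of pairs, since
  \<open>E\<close> itself need not be closed.\<close>

lemma perfect_scheme:
  assumes "E \<in> sets (borel :: (nat \<Rightarrow> int) measure)" "uncountable E"
  obtains e :: "nat list \<Rightarrow> int list" where
    "\<And>s s' v m m'. length s = length s' \<Longrightarrow> seg v m = e s \<Longrightarrow> seg v m' = e s' \<Longrightarrow> s = s'"
    "\<And>y. \<exists>v\<in>E. \<forall>n. \<exists>m. seg v m = e (seg y n)"
proof -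
  obtain Q where "projects_to Q E"
    using borel_projects_to[OF assms(1)] ..
  note Q = this[unfolded projects_to_def]
  define R where "R l = Q (map fst l) (map snd l)" for l :: "(int \<times> nat) list"
  have E: "E = branch_through R []"
  proof (intro set_eqI iffI)
    fix v assume "v \<in> E"
    then obtain w where w: "\<forall>n. Q (seg v n) (seg w n)" unfolding Q by blast
    show "v \<in> branch_through R []"
      unfolding branch_through_def
      by (rule CollectI, rule exI[of _ "\<lambda>i. (v i, w i)"]) (use w in \<open>auto simp: R_def o_def\<close>)
  next
    fix v assume "v \<in> branch_through R []"
    then obtain b where b: "v = fst \<circ> b" "\<And>n. R (seg b n)"
      by (auto simp: branch_through_def)
    show "v \<in> E"
      unfolding Q by (rule CollectI, rule exI[of _ "snd \<circ> b"]) (use b in \<open>auto simp: R_def\<close>)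
  qed
  define fat where "fat t \<longleftrightarrow> uncountable (branch_through R t)" for t
  define is_split where "is_split t t0 t1 \<longleftrightarrow> fat t0 \<and> fat t1 \<and> strict_prefix t t0 \<and> strict_prefix t t1 \<and>
    (\<forall>v m m'. \<not> (seg v m = map fst t0 \<and> seg v m' = map fst t1))" for t t0 t1
  have "\<exists>t0 t1. is_split t t0 t1" if "fat t" for t
    using uncountable_split[OF that[unfolded fat_def]] unfolding fat_def is_split_def .
  then obtain lf rt where "\<And>t. fat t \<Longrightarrow> is_split t (lf t) (rt t)"
    by metis
  then have lf: "\<And>t. fat t \<Longrightarrow> fat (lf t)" "\<And>t. fat t \<Longrightarrow> strict_prefix t (lf t)" and
    rt: "\<And>t. fat t \<Longrightarrow> fat (rt t)" "\<And>t. fat t \<Longrightarrow> strict_prefix t (rt t)" and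
    lf_rt: "\<And>t v m m'. fat t \<Longrightarrow> seg v m = map fst (lf t) \<Longrightarrow> seg v m' = map fst (rt t) \<Longrightarrow> False"
    unfolding is_split_def by blast+
  have rt_pow: "fat ((rt ^^ k) t) \<and> prefix t ((rt ^^ k) t)" if "fat t" for k t
  proof (induction k)
    case (Suc k)
    then show ?case
      using rt(1)[of "(rt ^^ k) t"] rt(2)[of "(rt ^^ k) t"]
        prefix_order.trans[of t "(rt ^^ k) t" "rt ((rt ^^ k) t)"] by (simp add: strict_prefix_def)
  qed (use that in simp)
  \<comment> \<open>Binary splitting is turned into infinite splitting: the child numbered
    \<open>k\<close> is reached by going right \<open>k\<close> times and then left.\<close>
  define step where "step t k = lf ((rt ^^ k) t)" for t k
  have step: "fat (step t k)" "strict_prefix t (step t k)" if "fat t" for t k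
    using rt_pow[OF that, of k] lf[of "(rt ^^ k) t"] prefix_order.le_less_trans
    unfolding step_def by blast+
  define node where "node s = foldl step [] s" for s
  have node_simps: "node [] = []" "node (s @ [k]) = step (node s) k" for s k
    by (simp_all add: node_def)
  have fat_node: "fat (node s)" for s
    by (induction s rule: rev_induct) (use assms(2) step in \<open>auto simp: node_simps fat_def E\<close>)
  have node_prefix: "prefix (node (seg y n)) (node (seg y n'))" if "n \<le> n'" for n n' y
    using that
  proof (induction n' rule: dec_induct)
    case (step k)
    then show ?case
      using \<open>fat (node (seg y k)) \<Longrightarrow> strict_prefix (node (seg y k)) (step (node (seg y k)) (y k))\<close>
        fat_node[of "seg y k"] prefix_order.trans
      by (auto simp: node_simps strict_prefix_def)
  qed simp
  have node_length: "n \<le> length (node (seg y n))" for n y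
  proof (induction n)
    case (Suc n)
    have "length (node (seg y n)) < length (node (seg y (Suc n)))"
      using step(2)[OF fat_node[of "seg y n"], of "y n"] prefix_length_less
      by (simp add: node_simps)
    then show ?case using Suc by linarith
  qed simp
  have prefix_seg: "\<exists>m. seg v m = map fst t" if "prefix t t'" "seg v m' = map fst t'" for v t t' m'
  proof
    have "map fst t = take (length t) (map fst t')"
      using that(1) by (auto simp: prefix_def)
    also have "\<dots> = seg v (length t)"
      using that prefix_length_le[OF that(1)]
      by (metis diff_zero length_map length_upt take_seg)
    finally show "seg v (length t) = map fst t" ..
  qed
  show ?thesis
  proof (rule that[of "\<lambda>s. map fst (node s)"])
    fix s s' v m m'
    assume "length s = length s'" "seg v m = map fst (node s)" "seg v m' = map fst (node s')"
    then show "s = s'"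
    proof (induction s arbitrary: s' m m' rule: rev_induct)
      case (snoc k u)
      then obtain k' u' where s': "s' = u' @ [k']" "length u' = length u"
        by (cases s' rule: rev_cases) auto
      have "prefix (node u) (node (u @ [k]))" "prefix (node u') (node (u' @ [k']))"
        using step(2)[OF fat_node] by (simp_all add: node_simps strict_prefix_def)
      then obtain l l' where "seg v l = map fst (node u)" "seg v l' = map fst (node u')"
        using prefix_seg snoc.prems(2,3) unfolding s'(1) by blast
      then have u: "u' = u"
        using snoc.IH[of u'] s'(2) by metis
      \<comment> \<open>For \<open>i < j\<close>, child \<open>j\<close> lies beyond the right half
        of the splitting at \<open>(rt ^^ i) (node u)\<close>, and child \<open>i\<close> is its
        left half.\<close>
      have no: False if "i < j" and a: "seg v a = map fst (step (node u) i)"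
          and a': "seg v a' = map fst (step (node u) j)"
        for i j a a'
      proof -
        have j: "(rt ^^ j) t = (rt ^^ (j - Suc i)) (rt ((rt ^^ i) t))" for t
          using that(1) funpow_add[of "j - Suc i" "Suc i" rt] by (simp add: fun_eq_iff)
        have f: "fat ((rt ^^ i) (node u))" "fat (rt ((rt ^^ i) (node u)))" "fat ((rt ^^ j) (node u))"
          using rt_pow[OF fat_node] rt(1) by blast+
        have "prefix (rt ((rt ^^ i) (node u))) ((rt ^^ j) (node u))"
          unfolding j using rt_pow[OF f(2)] by blast
        then have "prefix (rt ((rt ^^ i) (node u))) (step (node u) j)"
          using lf(2)[OF f(3)] unfolding step_def strict_prefix_def by (meson prefix_order.trans)
        then obtain c where "seg v c = map fst (rt ((rt ^^ i) (node u)))"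
          using prefix_seg a' by blast
        then show False
          using lf_rt[OF f(1)] a unfolding step_def by blast
      qed
      then have "k = k'"
        using snoc.prems(2,3) no unfolding s' u node_simps(2) by (metis linorder_neqE_nat)
      then show ?case using s' u by simp
    qed simp
  next
    fix y
    define b where "b i = node (seg y (Suc i)) ! i" for i
    have b: "seg b (length (node (seg y n))) = node (seg y n)" for n
    proof (rule nth_equalityI)
      fix j assume "j < length (seg b (length (node (seg y n))))"
      then have j: "j < length (node (seg y n))" by simp
      have "j < length (node (seg y (Suc j)))"
        using node_length[of "Suc j" y] by linarith
      then have "node (seg y (Suc j)) ! j = node (seg y n) ! j"
        using j node_prefix[of "Suc j" n y] node_prefix[of n "Suc j" y]
        by (cases "Suc j \<le> n") (auto simp: nth_append elim!: prefixE)
      then show "seg b (length (node (seg y n))) ! j = node (seg y n) ! j"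
        using j by (simp add: b_def)
    qed simp
    \<comment> \<open>The node at level \<open>n\<close> has length at least \<open>n\<close> and
      lies on some genuine branch, so \<open>b\<close> agrees with that branch up to
      \<open>n\<close>.\<close>
    have "R (seg b n)" for n
    proof -
      have "branch_through R (node (seg y n)) \<noteq> {}"
        using fat_node[of "seg y n"] unfolding fat_def by auto
      then obtain c where "seg c (length (node (seg y n))) = node (seg y n)" "R (seg c n)"
        unfolding branch_through_def by blast
      moreover have "seg b n = seg c n"
        using b[of n] calculation(1) node_length[of n y]
        by (metis take_seg)
      ultimately show ?thesis by (simp only:)
    qed
    then have "fst \<circ> b \<in> E"
      unfolding E branch_through_def by auto
    moreover have "seg (fst \<circ> b) (length (node (seg y n))) = map fst (node (seg y n))" for n
      using b[of n] by (metis map_map)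
    ultimately show "\<exists>v\<in>E. \<forall>n. \<exists>m. seg v m = map fst (node (seg y n))"
      by blast
  qed
qed

section \<open>Uniform measures on boxes\<close>

definition cyl :: "int list \<Rightarrow> (nat \<Rightarrow> int) set" where
  "cyl s = {v. seg v (length s) = s}"

lemma mem_cyl_iff: "v \<in> cyl s \<longleftrightarrow> (\<forall>i<length s. v i = s ! i)"
  unfolding cyl_def mem_Collect_eq list_eq_iff_nth_eq[of "seg v (length s)" s] by simp

lemma cyl_borel [measurable]: "cyl s \<in> sets borel"
proof -
  have "cyl s = {v \<in> space borel. \<forall>i<length s. v i = s ! i}"
    by (auto simp: mem_cyl_iff)
  also have "\<dots> \<in> sets borel" by measurable
  finally show ?thesis .
qed

lemma open_contains_cyl:
  fixes U :: "(nat \<Rightarrow> int) set"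
  assumes "open U" "v \<in> U"
  obtains n where "cyl (seg v n) \<subseteq> U"
proof -
  have "openin (product_topology (\<lambda>_. euclidean) UNIV) U"
    using assms(1) by (simp add: open_fun_def)
  from product_topology_open_contains_basis[OF this assms(2)]
  obtain X where X: "v \<in> (\<Pi>\<^sub>E i\<in>UNIV. X i)" "finite {i. X i \<noteq> UNIV}" "(\<Pi>\<^sub>E i\<in>UNIV. X i) \<subseteq> U"
    by auto
  obtain n where n: "\<And>i. X i \<noteq> UNIV \<Longrightarrow> i < n"
    using X(2) finite_nat_set_iff_bounded[of "{i. X i \<noteq> UNIV}"] by auto
  have "cyl (seg v n) \<subseteq> (\<Pi>\<^sub>E i\<in>UNIV. X i)"
  proof
    fix w assume "w \<in> cyl (seg v n)"
    then have "\<And>i. i < n \<Longrightarrow> w i = v i"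
      by (simp add: cyl_def)
    then show "w \<in> (\<Pi>\<^sub>E i\<in>UNIV. X i)"
    proof (simp add: PiE_UNIV_domain, intro Pi_I)
      fix i
      have "w i = v i \<or> X i = UNIV"
        using \<open>\<And>i. i < n \<Longrightarrow> w i = v i\<close> n by blast
      then show "w i \<in> X i"
        using X(1) by auto
    qed
  qed
  with X(3) have "cyl (seg v n) \<subseteq> U" by (rule subset_trans[rotated])
  then show ?thesis by (rule that)
qed

text \<open>
  Open sets are disjoint unions of cylinders, so the domination passes to open sets, and from there
  to null sets by outer regularity.
\<close>

lemma null_sets_dominated:
  fixes \<mu> \<nu> :: "(nat \<Rightarrow> int) measure"
  assumes fin: "finite_measure \<mu>" "finite_measure \<nu>"
    and sets: "sets \<mu> = sets borel" "sets \<nu> = sets borel"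
    and dom: "\<And>s. emeasure \<mu> (cyl s) \<le> ennreal C * emeasure \<nu> (cyl s)"
    and E: "E \<in> null_sets \<nu>"
  shows "E \<in> null_sets \<mu>"
proof -
  have dom_open: "emeasure \<mu> U \<le> ennreal C * emeasure \<nu> U" if "open U" for U
  proof -
    \<comment> \<open>Only the shortest strings whose cylinder fits into \<open>U\<close> are kept,
      which makes the cylinders disjoint.\<close>
    define S where "S = {s. cyl s \<subseteq> U \<and> (\<forall>j<length s. \<not> cyl (take j s) \<subseteq> U)}"
    have U: "U = (\<Union>s\<in>S. cyl s)"
    proof
      show "U \<subseteq> (\<Union>s\<in>S. cyl s)"
      proof
        fix v assume "v \<in> U"
        with \<open>open U\<close> obtain n where n: "cyl (seg v n) \<subseteq> U"
          by (rule open_contains_cyl)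
        define k where "k = (LEAST n. cyl (seg v n) \<subseteq> U)"
        have "cyl (seg v k) \<subseteq> U" "\<And>j. j < k \<Longrightarrow> \<not> cyl (seg v j) \<subseteq> U"
          using LeastI[of "\<lambda>n. cyl (seg v n) \<subseteq> U", OF n] not_less_Least
          unfolding k_def by auto
        then have "seg v k \<in> S"
          by (simp add: S_def take_map)
        moreover have "v \<in> cyl (seg v k)" by (simp add: cyl_def)
        ultimately show "v \<in> (\<Union>s\<in>S. cyl s)" by blast
      qed
    qed (auto simp: S_def)
    have short: False if "s \<in> S" "t \<in> S" "v \<in> cyl s" "v \<in> cyl t" "length s < length t" for s t v
    proof -
      have "take (length s) t = s"
        using that(3-5) unfolding cyl_def
        by (metis (mono_tags, lifting) less_imp_le mem_Collect_eq take_seg)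
      then show False
        using that(1,2,5) unfolding S_def by (metis (mono_tags, lifting) mem_Collect_eq)
    qed
    have disj: "disjoint_family_on cyl S"
      unfolding disjoint_family_on_def
    proof (intro ballI impI)
      fix s t assume st: "s \<in> S" "t \<in> S" "s \<noteq> t"
      have False if v: "v \<in> cyl s" "v \<in> cyl t" for v
      proof -
        have "length s = length t"
          using short[OF st(1,2) v] short[OF st(2,1) v(2,1)] by (meson linorder_neqE_nat)
        then show False using v st(3) by (simp add: cyl_def)
      qed
      then show "cyl s \<inter> cyl t = {}" by blast
    qed
    have "emeasure \<mu> U = (\<integral>\<^sup>+s. emeasure \<mu> (cyl s) \<partial>count_space S)"
      unfolding U using disj by (intro emeasure_UN_countable) (auto simp: sets)
    also have "\<dots> \<le> (\<integral>\<^sup>+s. ennreal C * emeasure \<nu> (cyl s) \<partial>count_space S)"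
      by (intro nn_integral_mono dom)
    also have "\<dots> = ennreal C * (\<integral>\<^sup>+s. emeasure \<nu> (cyl s) \<partial>count_space S)"
      by (intro nn_integral_cmult) auto
    also have "(\<integral>\<^sup>+s. emeasure \<nu> (cyl s) \<partial>count_space S) = emeasure \<nu> U"
      unfolding U using disj by (intro emeasure_UN_countable[symmetric]) (auto simp: sets)
    finally show ?thesis .
  qed
  have E_borel: "E \<in> sets borel"
    using E sets by auto
  have "emeasure \<mu> E \<le> 0 + ennreal \<epsilon>" if "\<epsilon> > 0" for \<epsilon> :: real
  proof -
    \<comment> \<open>The denominator stays positive for every real \<open>C\<close>, also for zero
      or negative ones.\<close>
    define \<delta> where "\<delta> = \<epsilon> / (1 + \<bar>C\<bar>)"
    have "\<delta> > 0" using that by (simp add: \<delta>_def)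
    have "emeasure \<nu> (space \<nu>) \<noteq> \<infinity>"
      using finite_measure.finite_emeasure_space[OF fin(2)] by simp
    from outer_regular[OF sets(2) this E_borel] E
    have "(INF U\<in>{U. E \<subseteq> U \<and> open U}. emeasure \<nu> U) < ennreal \<delta>"
      using \<open>\<delta> > 0\<close> by auto
    then obtain U where U: "E \<subseteq> U" "open U" "emeasure \<nu> U < ennreal \<delta>"
      unfolding INF_less_iff by blast
    have "emeasure \<mu> E \<le> emeasure \<mu> U"
      using U by (intro emeasure_mono) (auto simp: sets)
    also have "\<dots> \<le> ennreal C * emeasure \<nu> U" by (rule dom_open[OF U(2)])
    also have "\<dots> \<le> ennreal \<bar>C\<bar> * ennreal \<delta>"
      using U(3) by (intro mult_mono) (auto intro: ennreal_leI)
    also have "\<dots> = ennreal (\<bar>C\<bar> * \<delta>)"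
      using \<open>\<delta> > 0\<close> by (simp add: ennreal_mult)
    also have "\<dots> \<le> ennreal \<epsilon>"
      using that by (intro ennreal_leI) (simp add: \<delta>_def divide_simps mult_left_mono)
    finally show ?thesis by simp
  qed
  then have "emeasure \<mu> E \<le> 0" by (rule ennreal_le_epsilon)
  then show ?thesis
    using E_borel by (simp add: null_sets_def sets)
qed

text \<open>The digit at place \<open>n\<close> of the mixed radix expansion of \<open>r\<close>,
  with \<open>h i\<close> as the base at place \<open>i\<close>.\<close>

definition digits :: "(nat \<Rightarrow> nat) \<Rightarrow> real \<Rightarrow> nat \<Rightarrow> int" where
  "digits h r n = \<lfloor>(\<Prod>i<Suc n. real (h i)) * r\<rfloor> mod int (h n)"

abbreviation unif01 :: "real measure" where
  "unif01 \<equiv> uniform_measure lborel {0..<1}"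

definition box_measure :: "(nat \<Rightarrow> nat) \<Rightarrow> (nat \<Rightarrow> int) measure" where
  "box_measure h = distr unif01 borel (digits h)"

lemma prob_space_unif01: "prob_space unif01"
  by (rule prob_space_uniform_measure) auto

lemma measurable_digits [measurable]: "digits h \<in> borel_measurable borel"
proof -
  have "(\<lambda>r. digits h r n) \<in> measurable borel (count_space UNIV)" for n
    unfolding digits_def by measurable
  then show ?thesis by (simp add: measurable_nat_int_iff)
qed

lemma box_measure [simp]:
  "prob_space (box_measure h)" "sets (box_measure h) = sets borel" "space (box_measure h) = UNIV"
  unfolding box_measure_def
  by (auto intro!: prob_space.prob_space_distr prob_space_unif01)

lemma emeasure_box_measure:
  "A \<in> sets borel \<Longrightarrow> emeasure (box_measure h) A = emeasure lborel ({0..<1} \<inter> digits h -` A)"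
  unfolding box_measure_def
  by (subst emeasure_distr) (auto simp: divide_ennreal_def measurable_sets_borel[OF measurable_digits])

lemma null_sets_box_measure_iff:
  "A \<in> sets borel \<Longrightarrow> A \<in> null_sets (box_measure h) \<longleftrightarrow> {0..<1} \<inter> digits h -` A \<in> null_sets lborel"
  using measurable_sets_borel[OF measurable_digits, of A h]
  by (auto simp: null_sets_def emeasure_box_measure)

lemma floor_eq_interval:
  assumes "c > 0"
  shows "{r. \<lfloor>c * r\<rfloor> = k} = {of_int k / c..<(of_int k + 1) / c :: real}"
  using assms by (auto simp: floor_eq_iff field_simps)

lemma emeasure_floor_eq:
  assumes "c > (0::real)"
  shows "emeasure lborel {r. \<lfloor>c * r\<rfloor> = k} = ennreal (1 / c)"
  unfolding floor_eq_interval[OF assms]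
  using assms by (subst emeasure_lborel_Ico) (auto simp: field_simps)

lemma digits_step:
  assumes "h n \<ge> 1"
  shows "\<lfloor>(\<Prod>i<Suc n. real (h i)) * r\<rfloor> = \<lfloor>(\<Prod>i<n. real (h i)) * r\<rfloor> * int (h n) + digits h r n"
proof -
  have "\<lfloor>(\<Prod>i<n. real (h i)) * r\<rfloor> = \<lfloor>(\<Prod>i<Suc n. real (h i)) * r / real_of_int (int (h n))\<rfloor>"
    using assms by simp
  also have "\<dots> = \<lfloor>(\<Prod>i<Suc n. real (h i)) * r\<rfloor> div int (h n)"
    by (rule floor_divide_real_eq_div) simp
  finally show ?thesis
    unfolding digits_def by simp
qed

lemma digits_bounds: "h n \<ge> 1 \<Longrightarrow> 0 \<le> digits h r n \<and> digits h r n < int (h n)"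
  by (simp add: digits_def)

text \<open>Prescribing the first \<open>n\<close> digits prescribes the integer part of
  \<open>r\<close> times the product of the first \<open>n\<close> bases, which cuts out an interval
  of length one over that product.\<close>

lemma emeasure_box_measure_cyl:
  assumes h: "\<And>i. h i \<ge> 1"
  shows "emeasure (box_measure h) (cyl s) =
    (if \<forall>i<length s. 0 \<le> s ! i \<and> s ! i < int (h i) then ennreal (1 / (\<Prod>i<length s. real (h i))) else 0)"
proof (cases "\<forall>i<length s. 0 \<le> s ! i \<and> s ! i < int (h i)")
  case False
  then obtain i where i: "i < length s" "\<not> (0 \<le> s ! i \<and> s ! i < int (h i))"
    by blast
  have "digits h -` cyl s = {}"
  proof -
    have "digits h r i \<noteq> s ! i" for r
      using i(2) digits_bounds[of h i r, OF h] by metis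
    then show ?thesis
      using i(1) by (fastforce simp: mem_cyl_iff)
  qed
  then show ?thesis
    using False by (simp add: emeasure_box_measure if_not_P)
next
  case True
  define q where "q n = (\<Prod>i<n. real (h i))" for n
  \<comment> \<open>The integer with mixed radix digits \<open>s\<close>, evaluated by Horner's
    rule.\<close>
  define k where "k = rec_nat 0 (\<lambda>n j. j * int (h n) + s ! n)"
  have q: "q n > 0" for n
    unfolding q_def by (intro prod_pos) (use h in \<open>auto simp: Suc_le_eq\<close>)
  have k_simps: "k 0 = 0" "k (Suc n) = k n * int (h n) + s ! n" for n
    by (simp_all add: k_def)
  have iff: "(\<forall>i<n. digits h r i = s ! i) \<longleftrightarrow> \<lfloor>q n * r\<rfloor> = k n"
    if "n \<le> length s" "r \<in> {0..<1}" for n r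
    using that(1)
  proof (induction n)
    case 0
    have "\<lfloor>r\<rfloor> = 0" using that(2) by (auto simp: floor_eq_iff)
    then show ?case by (simp add: q_def k_simps)
  next
    case (Suc n)
    have "\<lfloor>q (Suc n) * r\<rfloor> = k (Suc n) \<longleftrightarrow>
        \<lfloor>q n * r\<rfloor> * int (h n) + digits h r n = k n * int (h n) + s ! n"
      unfolding k_simps q_def digits_step[of h n, OF h] ..
    also have "\<dots> \<longleftrightarrow> \<lfloor>q n * r\<rfloor> = k n \<and> digits h r n = s ! n" (is "?l \<longleftrightarrow> ?r")
    proof
      assume ?l
      moreover have "(\<lfloor>q n * r\<rfloor> * int (h n) + digits h r n) mod int (h n) = digits h r n"
        "(k n * int (h n) + s ! n) mod int (h n) = s ! n"
        using digits_bounds[of h n r, OF h] True Suc.prems by auto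
      ultimately have "digits h r n = s ! n" by metis
      with \<open>?l\<close> h[of n] show ?r by auto
    qed simp
    also have "\<dots> \<longleftrightarrow> (\<forall>i<Suc n. digits h r i = s ! i)"
      using Suc by (auto simp: less_Suc_eq)
    finally show ?case ..
  qed
  \<comment> \<open>This places the interval for \<open>k\<close> inside the unit interval, so that
    intersecting with \<open>{0..<1}\<close> loses no length.\<close>
  have k_bounds: "0 \<le> k n \<and> real_of_int (k n) + 1 \<le> q n" if "n \<le> length s" for n
    using that
  proof (induction n)
    case (Suc n)
    have "k n + 1 \<le> (\<Prod>i<n. int (h i))"
    proof -
      have "real_of_int (k n + 1) \<le> real_of_int (\<Prod>i<n. int (h i))"
        using Suc by (simp add: q_def)
      then show ?thesis by linarith
    qed
    then have "(k n + 1) * int (h n) \<le> (\<Prod>i<n. int (h i)) * int (h n)"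
      by (intro mult_right_mono) auto
    moreover have sn: "s ! n + 1 \<le> int (h n)" "0 \<le> s ! n"
      using True[rule_format, of n] Suc.prems by auto
    ultimately have "k (Suc n) + 1 \<le> (\<Prod>i<Suc n. int (h i))"
      by (simp add: k_simps algebra_simps)
    then have "real_of_int (k (Suc n) + 1) \<le> real_of_int (\<Prod>i<Suc n. int (h i))"
      by (simp only: of_int_le_iff)
    then show ?case
      using Suc sn by (simp add: q_def k_simps)
  qed (simp add: k_simps q_def)
  let ?n = "length s"
  have "{0..<1} \<inter> digits h -` cyl s = {0..<1} \<inter> {r. \<lfloor>q ?n * r\<rfloor> = k ?n}"
    using iff[OF order_refl] by (auto simp add: mem_cyl_iff simp del: atLeastLessThan_iff)
  also have "\<dots> = {r. \<lfloor>q ?n * r\<rfloor> = k ?n}"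
  proof -
    have "0 \<le> r \<and> r < 1" if "\<lfloor>q ?n * r\<rfloor> = k ?n" for r
    proof -
      have "real_of_int (k ?n) \<le> q ?n * r" "q ?n * r < real_of_int (k ?n) + 1"
        using that by linarith+
      moreover have "0 \<le> real_of_int (k ?n)" "real_of_int (k ?n) + 1 \<le> q ?n"
        using k_bounds[of ?n] by auto
      ultimately have "0 \<le> q ?n * r" "q ?n * r < q ?n * 1" by linarith+
      then show ?thesis
        using q[of ?n] by (simp add: zero_le_mult_iff)
    qed
    then show ?thesis by auto
  qed
  finally show ?thesis
    using True emeasure_floor_eq[OF q[of ?n], of "k ?n"]
    by (simp add: emeasure_box_measure q_def)
qed

text \<open>The preimage is covered by \<open>q\<close> intervals, one for each integer that the
  preceding digits can form, each of length one over \<open>q\<close> times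
  \<open>h n\<close>.\<close>

lemma emeasure_box_measure_coordinate:
  assumes h: "\<And>i. h i \<ge> 1"
  shows "emeasure (box_measure h) {v. v n = a} \<le> ennreal (1 / real (h n))"
proof -
  define q where "q = (\<Prod>i<n. h i)"
  have q: "real q > 0" "real q * real (h n) > 0" "h n > 0"
    using h by (auto simp: q_def prod_pos Suc_le_eq)
  have "{0..<1} \<inter> digits h -` {v. v n = a} \<subseteq>
      (\<Union>j<q. {r. \<lfloor>(real q * real (h n)) * r\<rfloor> = int j * int (h n) + a})"
  proof
    fix r assume r: "r \<in> {0..<1} \<inter> digits h -` {v. v n = a}"
    then have "0 \<le> real q * r" "real q * r < real q"
      using q by auto
    then have "0 \<le> \<lfloor>real q * r\<rfloor>" "\<lfloor>real q * r\<rfloor> < int q"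
      by (auto simp: floor_less_iff)
    moreover have "\<lfloor>(real q * real (h n)) * r\<rfloor> = \<lfloor>real q * r\<rfloor> * int (h n) + a"
      using digits_step[of h n r, OF h] r by (simp add: q_def)
    ultimately show "r \<in> (\<Union>j<q. {r. \<lfloor>(real q * real (h n)) * r\<rfloor> = int j * int (h n) + a})"
      by (intro UN_I[of "nat \<lfloor>real q * r\<rfloor>"]) (auto simp del: zero_le_floor simp: nat_less_iff)
  qed
  then have "emeasure (box_measure h) {v. v n = a} \<le>
      emeasure lborel (\<Union>j<q. {r. \<lfloor>(real q * real (h n)) * r\<rfloor> = int j * int (h n) + a})"
    by (subst emeasure_box_measure) (auto intro!: emeasure_mono)
  also have "\<dots> \<le> (\<Sum>j<q. emeasure lborel {r. \<lfloor>(real q * real (h n)) * r\<rfloor> = int j * int (h n) + a})"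
    by (rule emeasure_subadditive_finite) auto
  also have "\<dots> = (\<Sum>j<q. ennreal (1 / (real q * real (h n))))"
    by (intro sum.cong refl emeasure_floor_eq q)
  also have "\<dots> = ennreal (1 / real (h n))"
    using q by (simp add: ennreal_of_nat_eq_real_of_nat ennreal_mult[symmetric])
  finally show ?thesis .
qed

section \<open>Haar null subsets of the Baire space group\<close>

lemma measurable_translate [measurable]: "(\<lambda>v. v + c) \<in> measurable borel (borel :: (nat \<Rightarrow> int) measure)"
proof -
  have "(\<lambda>v. (v + c) i) \<in> measurable borel (count_space UNIV)" for i
    unfolding plus_fun_def by (rule measurable_compose[OF measurable_coordinate]) simp
  then show ?thesis
    by (simp add: measurable_nat_int_iff)
qed

lemma measurable_add_nat_int:
  "(\<lambda>p :: (nat \<Rightarrow> int) \<times> (nat \<Rightarrow> int). fst p + snd p) \<in> borel_measurable (borel \<Otimes>\<^sub>M borel)"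
proof -
  have "continuous_on UNIV (\<lambda>p :: (nat \<Rightarrow> int) \<times> (nat \<Rightarrow> int). fst p + snd p)"
    by (intro continuous_intros)
  then show ?thesis
    unfolding borel_prod by (rule borel_measurable_continuous_onI)
qed

text \<open>By commutativity one translation parameter replaces the two sides, and writing
  translates as preimages under a continuous map makes them visibly Borel.\<close>

definition killed_by :: "(nat \<Rightarrow> int) measure \<Rightarrow> (nat \<Rightarrow> int) set \<Rightarrow> bool" where
  "killed_by \<mu> B \<longleftrightarrow> prob_space \<mu> \<and> sets \<mu> = sets borel \<and> B \<in> sets borel \<and>
     (\<forall>c. {v. v + c \<in> B} \<in> null_sets \<mu>)"

lemma haar_null_iff_killed: "haar_null X \<longleftrightarrow> (\<exists>\<mu> B. killed_by \<mu> B \<and> X \<subseteq> B)"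
proof -
  have eq: "(\<lambda>x. g + x + h) ` B = {v. v + - (g + h) \<in> B}" for g h and B :: "(nat \<Rightarrow> int) set"
  proof (intro set_eqI iffI)
    fix v assume "v \<in> {v. v + - (g + h) \<in> B}"
    then show "v \<in> (\<lambda>x. g + x + h) ` B"
      by (intro image_eqI[of _ _ "v + - (g + h)"]) (auto simp: algebra_simps)
  qed (auto simp: algebra_simps)
  have "(\<forall>g h. (\<lambda>x. g + x + h) ` B \<in> null_sets \<mu>) \<longleftrightarrow> (\<forall>c. {v. v + c \<in> B} \<in> null_sets \<mu>)"
    for \<mu> and B :: "(nat \<Rightarrow> int) set"
  proof
    assume l: "\<forall>g h. (\<lambda>x. g + x + h) ` B \<in> null_sets \<mu>"
    show "\<forall>c. {v. v + c \<in> B} \<in> null_sets \<mu>"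
    proof
      fix c
      show "{v. v + c \<in> B} \<in> null_sets \<mu>"
        using l[rule_format, of "- c" 0] unfolding eq by simp
    qed
  qed (simp add: eq)
  then show ?thesis
    unfolding haar_null_def killed_by_def by (auto simp: conj_assoc)
qed

lemma translate_borel: "B \<in> sets borel \<Longrightarrow> {v :: nat \<Rightarrow> int. v + c \<in> B} \<in> sets borel"
  using measurable_sets_borel[OF measurable_translate, of B c] by (simp add: vimage_def)

lemma haar_null_subset: "haar_null X \<Longrightarrow> Y \<subseteq> X \<Longrightarrow> haar_null Y" for X Y :: "(nat \<Rightarrow> int) set"
  unfolding haar_null_iff_killed by (meson subset_trans)

lemma not_haar_null_UNIV: "\<not> haar_null (UNIV :: (nat \<Rightarrow> int) set)"
proof
  assume "haar_null (UNIV :: (nat \<Rightarrow> int) set)"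
  then obtain \<mu> :: "(nat \<Rightarrow> int) measure" where "prob_space \<mu>" "UNIV \<in> null_sets \<mu>"
    unfolding haar_null_iff_killed killed_by_def by (auto simp: top_unique)
  then show False
    using prob_space.emeasure_space_1[of \<mu>] sets.sets_into_space[of UNIV \<mu>]
    by (auto simp: null_sets_def top_unique)
qed

text \<open>
  The witness for a countable union is the distribution of the sum of independent \<open>X n\<close>, where \<open>X n\<close>
  has the distribution witnessing the \<open>n\<close>-th set but with its first \<open>n\<close> coordinates deleted, so
  that the sum is finite in each coordinate.
\<close>

lemma haar_null_UN:
  fixes X :: "nat \<Rightarrow> (nat \<Rightarrow> int) set"
  assumes "\<And>n. haar_null (X n)"
  shows "haar_null (\<Union>n. X n)"
proof -
  have "\<forall>n. \<exists>\<mu> B. killed_by \<mu> B \<and> X n \<subseteq> B"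
    using assms by (simp add: haar_null_iff_killed)
  then obtain \<mu> B where \<mu>: "\<And>n. killed_by (\<mu> n) (B n)" and X: "\<And>n. X n \<subseteq> B n"
    by metis
  have prob: "prob_space (\<mu> n)" and sets [measurable_cong, simp]: "sets (\<mu> n) = sets borel"
    and B: "B n \<in> sets borel" and kill: "\<And>c. {v. v + c \<in> B n} \<in> null_sets (\<mu> n)" for n
    using \<mu> unfolding killed_by_def by blast+
  define cut where "cut n v = (\<lambda>i. if i < n then 0 else v i)" for n :: nat and v :: "nat \<Rightarrow> int"
  \<comment> \<open>This is the sum of all \<open>cut n (x n)\<close>: at coordinate
    \<open>i\<close> the terms with \<open>n > i\<close> have been deleted.\<close>
  define Z where "Z x = (\<lambda>i. \<Sum>n\<le>i. x n i)" for x :: "nat \<Rightarrow> nat \<Rightarrow> int"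
  let ?P = "Pi\<^sub>M UNIV \<mu>"
  interpret P: prob_space ?P
    by (intro prob_space_PiM prob)
  have Z_measurable: "Z \<in> borel_measurable ?P"
    unfolding measurable_nat_int_iff Z_def
  proof
    fix i
    have comp: "(\<lambda>x. x n i) \<in> measurable ?P (count_space UNIV)" for n
    proof (rule measurable_compose[where f = "\<lambda>x. x n" and N = "\<mu> n" and g = "\<lambda>v. v i"])
      show "(\<lambda>x. x n) \<in> measurable ?P (\<mu> n)"
        by (rule measurable_component_singleton) simp
      show "(\<lambda>v. v i) \<in> measurable (\<mu> n) (count_space UNIV)"
        using measurable_coordinate[of i] measurable_cong_sets[OF sets refl] by blast
    qed
    have "(\<lambda>x. \<Sum>n\<le>j. x n i) \<in> measurable ?P (count_space UNIV)" for j
    proof (induction j)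
      case (Suc j)
      have "(\<lambda>x. a + x (Suc j) i) \<in> measurable ?P (count_space UNIV)" for a
        by (rule measurable_compose[OF comp]) simp
      from measurable_compose_countable[OF this Suc] show ?case by simp
    qed (simp add: comp)
    then show "(\<lambda>x. \<Sum>n\<le>i. x n i) \<in> measurable ?P (count_space UNIV)" .
  qed
  have Z_upd: "Z (x(n := v)) = cut n v + Z (x(n := 0))" for x n v
  proof
    fix i
    have "(\<Sum>k\<le>i. (x(n := v)) k i) = (\<Sum>k\<le>i. (if k = n then v i else 0) + (x(n := 0)) k i)"
      by (intro sum.cong) auto
    then show "Z (x(n := v)) i = (cut n v + Z (x(n := 0))) i"
      by (simp add: Z_def cut_def sum.distrib sum.delta)
  qed
  \<comment> \<open>Deleting the first \<open>n\<close> coordinates of \<open>v\<close> is a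
    translation by one of countably many finitely supported vectors, so the exceptional set is a
    countable union of parts of null translates.\<close>
  have null1: "{v. cut n v + c \<in> B n} \<in> null_sets (\<mu> n)" for n c
  proof -
    define ext where "ext s = (\<lambda>i. if i < length s then - s ! i else 0)" for s :: "int list"
    have "cut n v = v + ext (seg v n)" for v
      by (auto simp: cut_def ext_def)
    then have "{v. cut n v + c \<in> B n} = (\<Union>s. {v. v + (ext s + c) \<in> B n} \<inter> {v. seg v n = s})"
      by (auto simp: add.assoc)
    moreover have "{v. seg v n = s} \<in> sets borel" for s :: "int list"
    proof -
      have "{v. seg v n = s} = (if length s = n then cyl s else {})"
        by (auto simp: cyl_def)
      then show ?thesis by auto
    qed
    then have "{v. v + (ext s + c) \<in> B n} \<inter> {v. seg v n = s} \<in> null_sets (\<mu> n)" for s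
      using kill[of "ext s + c" n] by (intro null_set_Int2) auto
    ultimately show ?thesis
      by (simp add: null_sets_UN)
  qed
  \<comment> \<open>Fubini with the factor \<open>n\<close> split off: once the other factors are
    fixed, \<open>Z\<close> is a translate of \<open>cut n v\<close>, and \<open>null1\<close>
    applies.\<close>
  have null2: "Z -` E \<in> null_sets ?P" if E: "E = {v. v + c \<in> B n}" for E n c
  proof -
    have E_borel: "E \<in> sets borel" unfolding E by (rule translate_borel[OF B])
    let ?Q = "Pi\<^sub>M (UNIV - {n}) \<mu>" and ?f = "\<lambda>(v, x). x(n := v)"
    interpret Q: prob_space ?Q by (intro prob_space_PiM prob)
    interpret \<mu>n: prob_space "\<mu> n" by (rule prob)
    interpret QP: pair_sigma_finite "\<mu> n" ?Q ..
    have P_eq: "distr (\<mu> n \<Otimes>\<^sub>M ?Q) ?P ?f = ?P"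
      using distr_pair_PiM_eq_PiM[of "UNIV - {n}" \<mu> n] prob by (simp add: insert_UNIV)
    have f: "?f \<in> measurable (\<mu> n \<Otimes>\<^sub>M ?Q) ?P"
      using measurable_compose[OF measurable_pair_swap' measurable_add_dim[of n "UNIV - {n}" \<mu>]]
      by (simp add: insert_UNIV case_prod_unfold)
    have Zf: "(\<lambda>p. Z (?f p)) \<in> borel_measurable (\<mu> n \<Otimes>\<^sub>M ?Q)"
      by (rule measurable_compose[OF f Z_measurable])
    have "{p \<in> space (\<mu> n \<Otimes>\<^sub>M ?Q). Z ((snd p)(n := fst p)) \<notin> E} \<in> sets (\<mu> n \<Otimes>\<^sub>M ?Q)"
      using measurable_sets[OF Zf, of "- E"] E_borel
      by (simp add: vimage_def Int_def case_prod_unfold conj_commute borel_comp)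
    note meas = this
    have "AE x in ?Q. AE v in \<mu> n. Z (x(n := v)) \<notin> E"
    proof (rule AE_I2)
      fix x
      have "Z (x(n := v)) \<in> E \<longleftrightarrow> cut n v + (Z (x(n := 0)) + c) \<in> B n" for v
        unfolding E by (subst Z_upd) (simp add: add.assoc)
      then have "{v. Z (x(n := v)) \<in> E} = {v. cut n v + (Z (x(n := 0)) + c) \<in> B n}"
        by blast
      then show "AE v in \<mu> n. Z (x(n := v)) \<notin> E"
        using null1[of n] by (auto intro: AE_I')
    qed
    then have "AE v in \<mu> n. AE x in ?Q. Z (x(n := v)) \<notin> E"
      using QP.AE_commute[of "\<lambda>v x. Z (x(n := v)) \<notin> E", OF meas] by blast
    then have "AE p in \<mu> n \<Otimes>\<^sub>M ?Q. Z (?f p) \<notin> E"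
      using QP.AE_pair_measure[of "\<lambda>p. Z ((snd p)(n := fst p)) \<notin> E", OF meas]
      by (simp add: case_prod_unfold)
    then have "AE x in distr (\<mu> n \<Otimes>\<^sub>M ?Q) ?P ?f. Z x \<notin> E"
      using f E_borel Z_measurable by (subst AE_distr_iff) auto
    then have "AE x in ?P. Z x \<notin> E" by (simp only: P_eq)
    then show ?thesis
      using measurable_sets[OF Z_measurable E_borel]
      by (simp add: AE_iff_null space_PiM sets_eq_imp_space_eq[OF sets] vimage_def)
  qed
  have "killed_by (distr ?P borel Z) (\<Union>n. B n)"
    unfolding killed_by_def
  proof (intro conjI allI)
    show "prob_space (distr ?P borel Z)"
      by (rule P.prob_space_distr[OF Z_measurable])
    show "(\<Union>n. B n) \<in> sets borel" using B by blast
    fix c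
    have eq: "{v. v + c \<in> (\<Union>n. B n)} = (\<Union>n. {v. v + c \<in> B n})" by blast
    have "{v. v + c \<in> B n} \<in> null_sets (distr ?P borel Z)" for n
      using null2[OF refl, of c n] translate_borel[OF B]
      by (simp add: null_sets_distr_iff[OF Z_measurable] space_PiM sets_eq_imp_space_eq[OF sets])
    then show "{v. v + c \<in> (\<Union>n. B n)} \<in> null_sets (distr ?P borel Z)"
      unfolding eq by (rule null_sets_UN)
  qed simp
  then show ?thesis
    unfolding haar_null_iff_killed using X by blast
qed

lemma haar_null_countable_Union:
  assumes "countable \<A>" "\<A> \<subseteq> HN"
  shows "\<Union>\<A> \<in> HN"
proof (cases "\<A> = {}")
  case True
  have "haar_null ({} :: (nat \<Rightarrow> int) set)"
    unfolding haar_null_iff_killed killed_by_def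
    by (intro exI[of _ "box_measure (\<lambda>_. 1)"] exI[of _ "{}"]) simp
  then show ?thesis using True by (simp add: HN_def)
next
  case False
  then have "\<A> = range (from_nat_into \<A>)"
    using assms(1) by (simp add: range_from_nat_into)
  moreover have "haar_null (from_nat_into \<A> n)" for n
    using from_nat_into[OF False] assms(2) by (auto simp: HN_def)
  ultimately show ?thesis
    using haar_null_UN[of "from_nat_into \<A>"] by (simp add: HN_def)
qed

section \<open>Box measures witness Haar nullness\<close>

text \<open>Tightness, one coordinate at a time: large values of coordinate \<open>n\<close> receive
  small mass, and the masses lost add up to at most one half.\<close>

lemma ex_box_positive:
  fixes \<mu> :: "(nat \<Rightarrow> int) measure"
  assumes "prob_space \<mu>" and sets: "sets \<mu> = sets borel"
  obtains m :: "nat \<Rightarrow> nat" where "{v. \<forall>n. \<bar>v n\<bar> \<le> int (m n)} \<in> sets \<mu>"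
    "{v. \<forall>n. \<bar>v n\<bar> \<le> int (m n)} \<notin> null_sets \<mu>"
proof -
  interpret prob_space \<mu> by fact
  have space: "space \<mu> = UNIV" using sets_eq_imp_space_eq[OF sets] by simp
  define A where "A n k = {v :: nat \<Rightarrow> int. \<bar>v n\<bar> > int k}" for n k
  have A_borel: "A n k \<in> sets borel" for n k
  proof -
    have "A n k = {v \<in> space borel. v n \<in> {j. \<bar>j\<bar> > int k}}" by (simp add: A_def)
    also have "\<dots> \<in> sets borel" by measurable
    finally show ?thesis .
  qed
  \<comment> \<open>The exponent \<open>n + 2\<close> makes the geometric series sum to
    \<open>1/2\<close>.\<close>
  have "\<exists>k. measure \<mu> (A n k) < (1/2) ^ (n + 2)" for n
  proof -
    have "(\<lambda>k. measure \<mu> (A n k)) \<longlonglongrightarrow> measure \<mu> (\<Inter>k. A n k)"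
    proof (rule finite_Lim_measure_decseq)
      show "decseq (A n)"
        by (auto simp: decseq_def A_def)
    qed (use A_borel sets in auto)
    moreover have "(\<Inter>k. A n k) = {}"
    proof -
      have "v \<notin> A n (nat \<bar>v n\<bar>)" for v by (simp add: A_def)
      then show ?thesis by blast
    qed
    ultimately have "(\<lambda>k. measure \<mu> (A n k)) \<longlonglongrightarrow> 0" by simp
    from order_tendstoD(2)[OF this, of "(1/2) ^ (n + 2)"] show ?thesis
      by (auto simp: eventually_sequentially)
  qed
  then obtain m where m: "\<And>n. measure \<mu> (A n (m n)) < (1/2) ^ (n + 2)" by metis
  let ?D = "{v. \<forall>n. \<bar>v n\<bar> \<le> int (m n)}"
  have D: "?D = UNIV - (\<Union>n. A n (m n))"
    by (simp add: A_def set_eq_iff not_less)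
  have geo: "(\<lambda>n. (1/2) ^ (n + 2) :: real) sums (1/2)"
    using sums_mult[OF geometric_sums[of "1/2::real"], of "1/4"] by simp
  have summable: "summable (\<lambda>n. measure \<mu> (A n (m n)))"
    by (rule summable_comparison_test'[OF sums_summable[OF geo], of 0]) (use m in \<open>auto intro: less_imp_le\<close>)
  have "measure \<mu> (\<Union>n. A n (m n)) \<le> (\<Sum>n. measure \<mu> (A n (m n)))"
    by (rule finite_measure_subadditive_countably) (use A_borel sets summable in auto)
  also have "\<dots> \<le> (\<Sum>n. (1/2) ^ (n + 2))"
    by (intro suminf_le less_imp_le[OF m] summable sums_summable[OF geo])
  finally have "measure \<mu> (\<Union>n. A n (m n)) \<le> 1/2"
    using sums_unique[OF geo] by simp
  moreover have "(\<Union>n. A n (m n)) \<in> sets \<mu>"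
    unfolding sets using A_borel by blast
  moreover from this have "measure \<mu> ?D = 1 - measure \<mu> (\<Union>n. A n (m n))"
    unfolding D using prob_compl space by simp
  ultimately have "measure \<mu> ?D > 0" "?D \<in> sets \<mu>"
    unfolding D using space by (auto intro: sets.Diff sets.top simp: sets)
  then show ?thesis
    using measure_eq_0_null_sets[of ?D \<mu>] by (intro that[of m]) auto
qed

text \<open>Convolving \<open>\<mu>\<close> with the uniform measure on a wider box \<open>H\<close>
  still kills \<open>B\<close>. Fixing a suitable summand \<open>v\<close> drawn from
  \<open>\<mu>\<close> leaves a shifted \<open>H\<close>-box measure, which dominates the shifted
  \<open>h\<close>-box measure up to a constant.\<close>

lemma killed_by_box_measure:
  assumes "killed_by \<mu> B"
  shows "\<exists>h0. \<forall>h. (\<forall>n. h n \<ge> 1) \<longrightarrow> eventually_dominated h0 h \<longrightarrow> killed_by (box_measure h) B"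
proof -
  have prob: "prob_space \<mu>" and sets [measurable_cong]: "sets \<mu> = sets borel" and B [measurable]: "B \<in> sets borel"
    and kill: "\<And>c. {v. v + c \<in> B} \<in> null_sets \<mu>"
    using assms unfolding killed_by_def by blast+
  interpret \<mu>: prob_space \<mu> by (rule prob)
  obtain m where m: "{v. \<forall>n. \<bar>v n\<bar> \<le> int (m n)} \<in> sets \<mu>" "{v. \<forall>n. \<bar>v n\<bar> \<le> int (m n)} \<notin> null_sets \<mu>"
    using ex_box_positive[OF prob sets] .
  \<comment> \<open>The factor \<open>2 ^ n\<close> makes the relative widenings
    \<open>2 * m n / h n\<close> summable, already when \<open>h\<close> dominates \<open>h0\<close>
    eventually.\<close>
  define h0 where "h0 n = 2 ^ n * (2 * m n)" for n
  have "killed_by (box_measure h) B" if h1: "\<And>n. h n \<ge> 1" and dom: "eventually_dominated h0 h" for h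
  proof -
    \<comment> \<open>The margin of \<open>m n\<close> on both sides absorbs every shift by
      \<open>v\<close> with \<open>\<bar>v n\<bar> \<le> int (m n)\<close>.\<close>
    define H where "H n = h n + 2 * m n" for n
    have H1: "H n \<ge> 1" for n using h1[of n] by (simp add: H_def)
    have "{v. v + c \<in> B} \<in> null_sets (box_measure h)" for c
    proof -
      \<comment> \<open>Starting the wider box \<open>m n\<close> below \<open>c n\<close> lets its
        shift by \<open>v\<close> contain the \<open>h\<close>-box at \<open>c\<close>.\<close>
      define c' where "c' n = c n - int (m n)" for n
      interpret H: prob_space "box_measure H" by simp
      interpret pair_sigma_finite "box_measure H" \<mu> ..
      \<comment> \<open>Exchanging the order of the two quantifiers gives, for almost every
        \<open>v\<close>, a null translate of \<open>B\<close> under \<open>H\<close>; some such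
        \<open>v\<close> lies in the box of positive mass.\<close>
      have "AE u in box_measure H. AE v in \<mu>. u + v + c' \<notin> B"
      proof (rule AE_I2)
        fix u
        have "{v. u + v + c' \<in> B} \<in> null_sets \<mu>"
          using kill[of "u + c'"] by (simp add: add.assoc add.left_commute)
        then show "AE v in \<mu>. u + v + c' \<notin> B"
          by (auto intro: AE_I')
      qed
      moreover have "{p \<in> space (box_measure H \<Otimes>\<^sub>M \<mu>). fst p + snd p + c' \<notin> B} \<in> sets (box_measure H \<Otimes>\<^sub>M \<mu>)"
      proof -
        have [measurable]: "(\<lambda>p. fst p + snd p + c') \<in> measurable (box_measure H \<Otimes>\<^sub>M \<mu>) borel"
          using measurable_compose[OF measurable_add_nat_int measurable_translate, of c']
          by (simp add: measurable_cong_sets[OF sets_pair_measure_cong[OF box_measure(2) sets] refl])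
        show ?thesis by measurable
      qed
      ultimately have "AE v in \<mu>. AE u in box_measure H. u + v + c' \<notin> B"
        by (subst (asm) AE_commute)
      then obtain N where N: "N \<in> null_sets \<mu>"
        "\<And>v. v \<in> space \<mu> - N \<Longrightarrow> AE u in box_measure H. u + v + c' \<notin> B"
        by (auto elim!: AE_E3)
      obtain v where "v \<in> {v. \<forall>n. \<bar>v n\<bar> \<le> int (m n)}" "v \<notin> N"
        using null_sets_subset[OF N(1) m(1)] m(2) by blast
      then have v: "\<And>n. \<bar>v n\<bar> \<le> int (m n)" and nullv: "AE u in box_measure H. u + v + c' \<notin> B"
        using N(2)[of v] sets_eq_imp_space_eq[OF sets] by auto
      define \<mu>1 where "\<mu>1 = distr (box_measure h) borel (\<lambda>u. u + c)"
      define \<mu>2 where "\<mu>2 = distr (box_measure H) borel (\<lambda>u. u + (v + c'))"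
      have tr: "(\<lambda>u. u + a) \<in> measurable (box_measure k) borel" for a k
        using measurable_translate[of a] measurable_cong_sets[OF box_measure(2) refl] by blast
      have cyl_tr: "(\<lambda>u. u + a) -` cyl s = cyl (map (\<lambda>i. s ! i - a i) [0..<length s])" for a s
        by (auto simp: mem_cyl_iff algebra_simps)
      have "summable (\<lambda>n. 2 * real (m n) / real (h n))"
      proof (rule summable_comparison_test_ev)
        show "\<forall>\<^sub>F n in sequentially. norm (2 * real (m n) / real (h n)) \<le> (1/2) ^ n"
          using dom unfolding eventually_dominated_def
        proof eventually_elim
          case (elim n)
          then have "real (2 ^ n * (2 * m n)) \<le> real (h n)"
            unfolding h0_def of_nat_le_iff .
          then show ?case
            using h1[of n] by (simp add: field_simps power_one_over)
        qed
      qed (simp add: summable_geometric)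
      \<comment> \<open>Bounds every finite product of the ratios \<open>H i / h i\<close>, by
        \<open>1 + t \<le> exp t\<close>.\<close>
      define C where "C = exp (\<Sum>n. 2 * real (m n) / real (h n))"
      have prod_le: "1 / (\<Prod>i<k. real (h i)) \<le> C * (1 / (\<Prod>i<k. real (H i)))" for k
      proof -
        have pos: "(\<Prod>i<k. real (h i)) > 0" "(\<Prod>i<k. real (H i)) > 0"
          using h1 H1 by (auto intro!: prod_pos simp: Suc_le_eq)
        have "(\<Prod>i<k. real (H i)) / (\<Prod>i<k. real (h i)) = (\<Prod>i<k. 1 + 2 * real (m i) / real (h i))"
        proof -
          have "real (H i) / real (h i) = 1 + 2 * real (m i) / real (h i)" for i
            using h1[of i] by (simp add: H_def field_simps)
          then show ?thesis by (simp add: prod_dividef[symmetric])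
        qed
        also have "\<dots> \<le> (\<Prod>i<k. exp (2 * real (m i) / real (h i)))"
        proof (rule prod_mono)
          fix i
          show "0 \<le> 1 + 2 * real (m i) / real (h i) \<and>
              1 + 2 * real (m i) / real (h i) \<le> exp (2 * real (m i) / real (h i))"
            using exp_ge_add_one_self[of "2 * real (m i) / real (h i)"] by simp
        qed
        also have "\<dots> = exp (\<Sum>i<k. 2 * real (m i) / real (h i))"
          by (simp add: exp_sum)
        also have "\<dots> \<le> C"
          unfolding C_def using \<open>summable _\<close> by (auto intro!: sum_le_suminf)
        finally show ?thesis using pos by (simp add: field_simps)
      qed
      have "B \<in> null_sets \<mu>1"
      proof (rule null_sets_dominated)
        show "finite_measure \<mu>1" "finite_measure \<mu>2"
          unfolding \<mu>1_def \<mu>2_def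
          by (intro prob_space.finite_measure prob_space.prob_space_distr[OF box_measure(1)] tr)+
        have "{u. u + (v + c') \<in> B} \<in> null_sets (box_measure H)"
          using nullv translate_borel[OF B, of "v + c'"]
          by (simp add: AE_iff_null add.assoc)
        then show "B \<in> null_sets \<mu>2"
          unfolding \<mu>2_def null_sets_distr_iff[OF tr] using B by (simp add: vimage_def)
        fix s
        let ?s1 = "map (\<lambda>i. s ! i - c i) [0..<length s]"
        let ?s2 = "map (\<lambda>i. s ! i - (v + c') i) [0..<length s]"
        have e1: "emeasure \<mu>1 (cyl s) = emeasure (box_measure h) (cyl ?s1)"
          unfolding \<mu>1_def by (subst emeasure_distr[OF tr]) (auto simp: cyl_tr)
        have e2: "emeasure \<mu>2 (cyl s) = emeasure (box_measure H) (cyl ?s2)"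
          unfolding \<mu>2_def by (subst emeasure_distr[OF tr]) (auto simp: cyl_tr)
        show "emeasure \<mu>1 (cyl s) \<le> ennreal C * emeasure \<mu>2 (cyl s)"
        proof (cases "\<forall>i<length s. 0 \<le> s ! i - c i \<and> s ! i - c i < int (h i)")
          case False
          then have "emeasure \<mu>1 (cyl s) = 0"
            unfolding e1 emeasure_box_measure_cyl[of h, OF h1] by auto
          then show ?thesis by simp
        next
          case True
          have "0 \<le> s ! i - (v + c') i \<and> s ! i - (v + c') i < int (H i)" if "i < length s" for i
            using True[rule_format, OF that] v[of i] by (auto simp: c'_def H_def)
          then have "emeasure \<mu>2 (cyl s) = ennreal (1 / (\<Prod>i<length s. real (H i)))"
            unfolding e2 emeasure_box_measure_cyl[of H, OF H1] by simp
          moreover have "emeasure \<mu>1 (cyl s) = ennreal (1 / (\<Prod>i<length s. real (h i)))"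
            using True unfolding e1 emeasure_box_measure_cyl[of h, OF h1] by simp
          ultimately show ?thesis
            using prod_le[of "length s"]
            by (simp add: C_def ennreal_mult[symmetric] prod_nonneg del: ennreal_mult)
        qed
      qed (simp_all add: \<mu>1_def \<mu>2_def)
      then show ?thesis
        unfolding \<mu>1_def null_sets_distr_iff[OF tr] by (simp add: vimage_def)
    qed
    then show ?thesis
      using B by (simp add: killed_by_def)
  qed
  then show ?thesis by blast
qed

section \<open>Graphs over orthants\<close>

definition orthant :: "(nat \<Rightarrow> bool) \<Rightarrow> (nat \<Rightarrow> int) set" where
  "orthant x = {v. \<forall>n. v n \<noteq> 0 \<and> (0 < v n \<longleftrightarrow> x n)}"

text \<open>Every box has a translate inside any given orthant.\<close>

lemma orthant_not_subset:
  assumes "killed_by \<mu> B"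
  shows "\<not> orthant x \<subseteq> B"
proof
  assume sub: "orthant x \<subseteq> B"
  have \<mu>: "prob_space \<mu>" "sets \<mu> = sets borel" and kill: "\<And>c. {v. v + c \<in> B} \<in> null_sets \<mu>"
    using assms unfolding killed_by_def by blast+
  obtain m where m: "{v. \<forall>n. \<bar>v n\<bar> \<le> int (m n)} \<in> sets \<mu>" "{v. \<forall>n. \<bar>v n\<bar> \<le> int (m n)} \<notin> null_sets \<mu>"
    using ex_box_positive[OF \<mu>] .
  define c where "c n = (if x n then int (m n) + 1 else - int (m n) - 1)" for n
  have "v + c \<in> orthant x" if "\<forall>n. \<bar>v n\<bar> \<le> int (m n)" for v
    unfolding orthant_def mem_Collect_eq
  proof
    fix n
    show "(v + c) n \<noteq> 0 \<and> (0 < (v + c) n \<longleftrightarrow> x n)"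
      using that[rule_format, of n] by (auto simp: c_def)
  qed
  then have "{v. \<forall>n. \<bar>v n\<bar> \<le> int (m n)} \<subseteq> {v. v + c \<in> B}"
    using sub by blast
  with null_sets_subset[OF kill m(1)] m(2) show False by blast
qed

text \<open>A value \<open>g x\<close> counts only if it lies in the orthant of \<open>x\<close>;
  otherwise that orthant contributes no point.\<close>

definition graph_set :: "((nat \<Rightarrow> bool) \<Rightarrow> nat \<Rightarrow> int) \<Rightarrow> (nat \<Rightarrow> int) set" where
  "graph_set g = {v. (\<forall>n. v n \<noteq> 0) \<and> v = g (\<lambda>n. 0 < v n)}"

text \<open>
  Two points of a translate of \<open>{0,1}\<^sup>\<omega>\<close> without zero coordinates lie in the same orthant, so the
  translate meets the graph in at most one point.
\<close>

lemma haar_null_graph_set: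
  assumes g: "(\<lambda>v :: nat \<Rightarrow> int. g (\<lambda>n. 0 < v n)) \<in> borel_measurable borel"
  shows "haar_null (graph_set g)"
proof -
  have [measurable]: "(\<lambda>v :: nat \<Rightarrow> int. g (\<lambda>n. 0 < v n) i) \<in> measurable borel (count_space UNIV)" for i
    using g unfolding measurable_nat_int_iff by (rule spec)
  have "graph_set g = {v \<in> space borel. \<forall>i. v i \<noteq> 0 \<and> v i = g (\<lambda>n. 0 < v n) i}"
    by (auto simp: graph_set_def fun_eq_iff)
  also have "\<dots> \<in> sets borel" by measurable
  finally have borel: "graph_set g \<in> sets borel" .
  let ?\<mu> = "box_measure (\<lambda>_. 2)"
  have "{v. v + c \<in> graph_set g} \<in> null_sets ?\<mu>" for c
  proof -
    let ?E = "{v. v + c \<in> graph_set g}"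
    have E_borel: "?E \<in> sets borel" by (rule translate_borel[OF borel])
    have bounds: "0 \<le> u n \<and> u n \<le> 1" if u: "u \<in> range (digits (\<lambda>_. 2))" for u n
    proof -
      obtain r where "u = digits (\<lambda>_. 2) r" using u by (rule rangeE)
      then show ?thesis using digits_bounds[of "\<lambda>_. 2" n r] by simp
    qed
    have unique: "u = u'" if u: "u \<in> range (digits (\<lambda>_. 2))" "u' \<in> range (digits (\<lambda>_. 2))"
      "u \<in> ?E" "u' \<in> ?E" for u u'
    proof -
      have "0 < (u + c) n \<longleftrightarrow> 0 < (u' + c) n" for n
      proof -
        have "0 \<le> u n \<and> u n \<le> 1" "0 \<le> u' n \<and> u' n \<le> 1"
          using bounds u(1,2) by blast+
        moreover have "(u + c) n \<noteq> 0" "(u' + c) n \<noteq> 0"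
          using u(3,4) unfolding graph_set_def by blast+
        ultimately show ?thesis unfolding plus_fun_def by presburger
      qed
      then have "(\<lambda>n. 0 < (u + c) n) = (\<lambda>n. 0 < (u' + c) n)" by blast
      moreover have "u + c = g (\<lambda>n. 0 < (u + c) n)" "u' + c = g (\<lambda>n. 0 < (u' + c) n)"
        using u(3,4) unfolding graph_set_def by blast+
      ultimately have "u + c = u' + c" by simp
      then show ?thesis by simp
    qed
    have "emeasure ?\<mu> ?E \<le> 0 + ennreal \<epsilon>" if "\<epsilon> > 0" for \<epsilon> :: real
    proof (cases "\<exists>u. u \<in> range (digits (\<lambda>_. 2)) \<and> u \<in> ?E")
      case True
      then obtain u where u: "u \<in> range (digits (\<lambda>_. 2))" "u \<in> ?E" by blast
      obtain k where k: "(1/2::real) ^ k < \<epsilon>"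
        using real_arch_pow_inv[of \<epsilon> "1/2"] \<open>\<epsilon> > 0\<close> by auto
      \<comment> \<open>The one possible point is null because it lies in cylinders of arbitrarily
        small measure.\<close>
      have "digits (\<lambda>_. 2) -` ?E \<subseteq> digits (\<lambda>_. 2) -` cyl (seg u k)"
      proof
        fix r assume "r \<in> digits (\<lambda>_. 2) -` ?E"
        then have "digits (\<lambda>_. 2) r = u"
          by (intro unique u) auto
        then show "r \<in> digits (\<lambda>_. 2) -` cyl (seg u k)"
          by (simp add: mem_cyl_iff)
      qed
      then have "emeasure ?\<mu> ?E \<le> emeasure ?\<mu> (cyl (seg u k))"
        unfolding emeasure_box_measure[OF E_borel] emeasure_box_measure[OF cyl_borel]
        using measurable_sets_borel[OF measurable_digits cyl_borel] by (intro emeasure_mono) auto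
      also have "\<dots> \<le> ennreal ((1/2) ^ k)"
        by (subst emeasure_box_measure_cyl) (auto simp: power_one_over)
      also have "\<dots> \<le> ennreal \<epsilon>"
        using k by (intro ennreal_leI) simp
      finally show ?thesis by simp
    next
      case False
      then have "digits (\<lambda>_. 2) -` ?E = {}" by blast
      then show ?thesis
        unfolding emeasure_box_measure[OF E_borel] by simp
    qed
    then have "emeasure ?\<mu> ?E \<le> 0" by (rule ennreal_le_epsilon)
    then show ?thesis using E_borel by (simp add: null_sets_def)
  qed
  then have "killed_by ?\<mu> (graph_set g)"
    unfolding killed_by_def using borel by simp
  then show ?thesis
    unfolding haar_null_iff_killed by blast
qed

section \<open>Borel selection of branches\<close>

primrec leftmost :: "('a::countable list \<Rightarrow> bool) \<Rightarrow> nat \<Rightarrow> 'a list" where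
  "leftmost P 0 = []"
| "leftmost P (Suc n) = leftmost P n @ [from_nat (LEAST k. P (leftmost P n @ [from_nat k]))]"

lemma leftmost_in:
  assumes "P []" "\<And>t. P t \<Longrightarrow> \<exists>a. P (t @ [a])"
  shows "P (leftmost P n)"
proof (induction n)
  case (Suc n)
  then obtain a where "P (leftmost P n @ [a])" using assms(2) by blast
  then have "P (leftmost P n @ [from_nat (to_nat a)])" by simp
  then show ?case unfolding leftmost.simps by (rule LeastI)
qed (simp add: assms(1))

lemma leftmost_eq_seg: "leftmost P n = seg (\<lambda>i. last (leftmost P (Suc i))) n"
  by (induction n) simp_all

text \<open>Taking the child with the least code, instead of an arbitrary choice, makes each node a
  Borel function of the parameter.\<close>

lemma measurable_leftmost:
  fixes P :: "'p \<Rightarrow> 'a::countable list \<Rightarrow> bool"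
  assumes "\<And>t. Measurable.pred M (\<lambda>p. P p t)"
  shows "(\<lambda>p. leftmost (P p) n) \<in> measurable M (count_space UNIV)"
proof (induction n)
  case (Suc n)
  have "(\<lambda>p. LEAST k. P p (t @ [from_nat k])) \<in> measurable M (count_space UNIV)" for t
    by (rule measurable_Least) (rule assms)
  then have "(\<lambda>p. t @ [from_nat (LEAST k. P p (t @ [from_nat k]))]) \<in> measurable M (count_space UNIV)" for t
    by (rule measurable_compose) simp
  from measurable_compose_countable[OF this Suc] show ?case by simp
qed simp

section \<open>The additivity\<close>

text \<open>The pattern \<open>x\<close> is used twice: as the set of codes of admissible nodes, and
  as the index of the orthant in which the first coordinates must lie.\<close>

definition coded_tree :: "(nat \<Rightarrow> bool) \<Rightarrow> (int \<times> nat) list \<Rightarrow> bool" where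
  "coded_tree x l \<longleftrightarrow> (\<forall>n\<le>length l. x (to_nat (take n l))) \<and>
     (\<forall>i<length l. fst (l ! i) \<noteq> 0 \<and> (0 < fst (l ! i) \<longleftrightarrow> x i))"

lemma coded_tree_branch:
  "(\<forall>n. coded_tree x (seg b n)) \<longleftrightarrow> (\<forall>n. x (to_nat (seg b n))) \<and> fst \<circ> b \<in> orthant x"
proof
  assume *: "\<forall>n. coded_tree x (seg b n)"
  have "x (to_nat (seg b n))" "fst (b n) \<noteq> 0 \<and> (0 < fst (b n) \<longleftrightarrow> x n)" for n
  proof -
    have "x (to_nat (take n (seg b (Suc n))))"
      "fst (seg b (Suc n) ! n) \<noteq> 0 \<and> (0 < fst (seg b (Suc n) ! n) \<longleftrightarrow> x n)"
      using *[rule_format, of "Suc n"] unfolding coded_tree_def by (simp_all del: upt_Suc)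
    then show "x (to_nat (seg b n))" "fst (b n) \<noteq> 0 \<and> (0 < fst (b n) \<longleftrightarrow> x n)"
      by (simp_all add: take_seg del: upt_Suc)
  qed
  then show "(\<forall>n. x (to_nat (seg b n))) \<and> fst \<circ> b \<in> orthant x"
    by (simp add: orthant_def)
qed (auto simp: coded_tree_def take_seg orthant_def)

text \<open>Where the pruned tree is empty or not yet stable the value is meaningless but harmless:
  the graph of any Borel map is Haar null.\<close>

definition leftmost_point :: "nat set \<Rightarrow> (nat \<Rightarrow> bool) \<Rightarrow> nat \<Rightarrow> int" where
  "leftmost_point \<xi> x n = fst (last (leftmost (prune (coded_tree x) \<xi>) (Suc n)))"

lemma haar_null_leftmost_graph: "haar_null (graph_set (leftmost_point \<xi>))"
proof (rule haar_null_graph_set)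
  have "Measurable.pred borel (\<lambda>v :: nat \<Rightarrow> int. coded_tree (\<lambda>n. 0 < v n) t)" for t
    unfolding coded_tree_def by measurable
  then have "Measurable.pred borel (\<lambda>v :: nat \<Rightarrow> int. prune (coded_tree (\<lambda>n. 0 < v n)) \<xi> t)" for t
    by (rule measurable_prune)
  then have "(\<lambda>v :: nat \<Rightarrow> int. leftmost (prune (coded_tree (\<lambda>n. 0 < v n)) \<xi>) n) \<in> measurable borel (count_space UNIV)" for n
    by (rule measurable_leftmost)
  then have "(\<lambda>v :: nat \<Rightarrow> int. fst (last (leftmost (prune (coded_tree (\<lambda>n. 0 < v n)) \<xi>) n))) \<in> measurable borel (count_space UNIV)" for n
    by (rule measurable_compose) simp
  then show "(\<lambda>v :: nat \<Rightarrow> int. leftmost_point \<xi> (\<lambda>n. 0 < v n)) \<in> borel_measurable borel"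
    unfolding measurable_nat_int_iff leftmost_point_def by blast
qed

text \<open>
  The diagonal argument: the orthant whose index codes a tree projecting to the complement of a
  Borel hull \<open>B\<close> contains a point outside \<open>B\<close>, and such a point is found by the leftmost branch of
  a sufficiently pruned tree.
\<close>

lemma leftmost_graphs_unbounded:
  assumes "killed_by \<mu> B"
  shows "\<not> (\<Union>\<xi>\<in>Field omega_1. graph_set (leftmost_point \<xi>)) \<subseteq> B"
proof
  assume sub: "(\<Union>\<xi>\<in>Field omega_1. graph_set (leftmost_point \<xi>)) \<subseteq> B"
  have "- B \<in> sets borel"
    using assms by (simp add: killed_by_def borel_comp)
  then obtain Q where "projects_to Q (- B)"
    using borel_projects_to by blast
  note Q = this[unfolded projects_to_def]
  define x where "x j = Q (map fst (from_nat j :: (int \<times> nat) list)) (map snd (from_nat j :: (int \<times> nat) list))" for j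
  have x: "x (to_nat l) \<longleftrightarrow> Q (map fst l) (map snd l)" for l
    by (simp add: x_def)
  have branch: "(\<forall>n. coded_tree x (seg b n)) \<longleftrightarrow>
      (\<forall>n. Q (seg (fst \<circ> b) n) (seg (snd \<circ> b) n)) \<and> fst \<circ> b \<in> orthant x" for b
    unfolding coded_tree_branch x map_map ..
  \<comment> \<open>This point outside the hull provides a branch, so the root survives all stages
    of pruning.\<close>
  obtain v where v: "v \<in> orthant x" "v \<in> - B"
    using orthant_not_subset[OF assms, of x] by blast
  then obtain w where w: "\<forall>n. Q (seg v n) (seg w n)"
    using Q by blast
  have b: "\<forall>n. coded_tree x (seg (\<lambda>i. (v i, w i)) n)"
    using branch[of "\<lambda>i. (v i, w i)"] v(1) w by (simp add: o_def)
  obtain \<xi> where \<xi>: "\<xi> \<in> Field omega_1"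
    "\<And>t. prune (coded_tree x) \<xi> t \<Longrightarrow> \<exists>a. prune (coded_tree x) \<xi> (t @ [a])"
    by (rule prune_stable[of "coded_tree x"]) blast
  have "prune (coded_tree x) \<xi> []"
    using prune_branch[of "coded_tree x" "\<lambda>i. (v i, w i)" \<xi> 0] b by simp
  then have pr: "prune (coded_tree x) \<xi> (leftmost (prune (coded_tree x) \<xi>) n)" for n
    by (rule leftmost_in[OF _ \<xi>(2)])
  define b' where "b' i = last (leftmost (prune (coded_tree x) \<xi>) (Suc i))" for i
  have "\<forall>n. coded_tree x (seg b' n)"
  proof
    fix n
    show "coded_tree x (seg b' n)"
      using prune_imp[OF pr[of n]] leftmost_eq_seg[of "prune (coded_tree x) \<xi>" n]
      unfolding b'_def by metis
  qed
  then have b': "\<forall>n. Q (seg (fst \<circ> b') n) (seg (snd \<circ> b') n)" "fst \<circ> b' \<in> orthant x"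
    unfolding branch by blast+
  have "(\<lambda>n. 0 < (fst \<circ> b') n) = x" "\<forall>n. (fst \<circ> b') n \<noteq> 0"
    using b'(2) unfolding orthant_def by blast+
  moreover have "fst \<circ> b' = leftmost_point \<xi> x"
    by (simp add: fun_eq_iff leftmost_point_def b'_def)
  ultimately have "fst \<circ> b' \<in> graph_set (leftmost_point \<xi>)"
    unfolding graph_set_def by simp
  then have "fst \<circ> b' \<in> B" using sub \<xi>(1) by blast
  moreover have "fst \<circ> b' \<in> - B" unfolding Q using b'(1) by blast
  ultimately show False by blast
qed

lemma leftmost_graphs_not_HN: "(\<Union>\<xi>\<in>Field omega_1. graph_set (leftmost_point \<xi>)) \<notin> HN"
  using leftmost_graphs_unbounded unfolding HN_def haar_null_iff_killed by blast

section \<open>Bounds on least cardinalities\<close>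

lemma min_card_ordLeq: "A \<in> F \<Longrightarrow> min_card F \<le>o |A|"
  by (rule min_card[of F]) auto

lemma ordLeq_min_card: "F \<noteq> {} \<Longrightarrow> (\<And>A. A \<in> F \<Longrightarrow> r \<le>o |A| ) \<Longrightarrow> r \<le>o min_card F"
  by (rule min_card[of F]) auto

lemma Card_order_min_card: "Card_order (min_card F)"
  by (simp add: min_card_def card_of_Card_order)

lemma omega_1_ordLeq_unbounded:
  assumes "\<A> \<subseteq> HN" "\<Union>\<A> \<notin> HN"
  shows "omega_1 \<le>o |\<A>|"
proof -
  have "\<not> |\<A>| <o omega_1"
    using haar_null_countable_Union[OF _ assms(1)] assms(2) countable_iff_ordLess_omega_1 by blast
  then show ?thesis
    using not_ordLess_iff_ordLeq[OF Well_order_omega_1 card_of_Well_order] by blast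
qed

lemma add_ideal_HN: "add_ideal HN =o omega_1"
proof -
  let ?A = "(\<lambda>\<xi>. graph_set (leftmost_point \<xi>)) ` Field omega_1"
  have "?A \<subseteq> HN"
    using haar_null_leftmost_graph by (auto simp: HN_def)
  moreover have "\<Union>?A \<notin> HN"
    by (rule leftmost_graphs_not_HN)
  ultimately have A: "?A \<in> {\<A>. \<A> \<subseteq> HN \<and> \<Union>\<A> \<notin> HN}" by simp
  then have "add_ideal HN \<le>o |?A|"
    unfolding add_ideal_def by (rule min_card_ordLeq)
  also have "|?A| \<le>o |Field omega_1|" by (rule card_of_image)
  also have "|Field omega_1| =o omega_1" by (rule card_of_Field_ordIso[OF Card_order_omega_1])
  finally have "add_ideal HN \<le>o omega_1" .
  moreover have "omega_1 \<le>o add_ideal HN"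
    unfolding add_ideal_def using A omega_1_ordLeq_unbounded by (intro ordLeq_min_card) auto
  ultimately show ?thesis by (simp add: ordIso_iff_ordLeq)
qed

section \<open>The cofinality\<close>

lemma measurable_seg [measurable]: "(\<lambda>v :: nat \<Rightarrow> int. seg v n) \<in> measurable borel (count_space UNIV)"
proof (rule measurable_count_space_eq_countable[THEN iffD2])
  have "{v. seg v n = s} \<in> sets borel" for s :: "int list"
  proof -
    have "{v. seg v n = s} = (if length s = n then cyl s else {})"
      by (auto simp: cyl_def)
    then show ?thesis by auto
  qed
  then show "(\<lambda>v. seg v n) \<in> space borel \<rightarrow> UNIV \<and>
      (\<forall>s\<in>UNIV. (\<lambda>v :: nat \<Rightarrow> int. seg v n) -` {s} \<inter> space borel \<in> sets borel)"
    by (simp add: vimage_def)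
qed simp

text \<open>The pattern \<open>x\<close> is read as a set of triples: node, place, label. The label
  at place \<open>i\<close> is the least one attached to any initial segment of
  \<open>z\<close>.\<close>

definition read_labels :: "(nat \<Rightarrow> int) \<Rightarrow> (nat \<Rightarrow> bool) \<Rightarrow> nat \<Rightarrow> nat" where
  "read_labels z x i = (LEAST k. \<exists>m. x (to_nat (seg z m, i, k)))"

text \<open>Signs come from \<open>x\<close> and absolute values from the labels, shifted by one to
  avoid zero. Every point of the orthant thus corresponds to exactly one sequence of labels.\<close>

definition labelled_point :: "(nat \<Rightarrow> int) \<Rightarrow> (nat \<Rightarrow> bool) \<Rightarrow> nat \<Rightarrow> int" where
  "labelled_point z x i = (if x i then 1 + int (read_labels z x i) else - 1 - int (read_labels z x i))"

lemma labelled_point_orthant: "labelled_point z x \<in> orthant x"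
  by (auto simp: labelled_point_def orthant_def)

lemma measurable_labelled_point:
  assumes z [measurable]: "z \<in> borel_measurable M"
    and x: "\<And>j. Measurable.pred M (\<lambda>p. x p j)"
  shows "(\<lambda>p. labelled_point (z p) (x p)) \<in> borel_measurable M"
  unfolding measurable_nat_int_iff
proof
  fix i :: nat
  have "Measurable.pred M (\<lambda>p. x p (to_nat (seg (z p) m, i, k)))" for m k
    by (rule measurable_compose_countable[where f = "\<lambda>s p. x p (to_nat (s, i, k))"])
       (rule x measurable_compose[OF z measurable_seg])+
  then have "Measurable.pred M (\<lambda>p. \<exists>m. x p (to_nat (seg (z p) m, i, k)))" for k
    by measurable
  then have [measurable]: "(\<lambda>p. read_labels (z p) (x p) i) \<in> measurable M (count_space UNIV)"
    unfolding read_labels_def by (rule measurable_Least)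
  have [measurable]: "Measurable.pred M (\<lambda>p. x p i)" by (rule x)
  show "(\<lambda>p. labelled_point (z p) (x p) i) \<in> measurable M (count_space UNIV)"
    unfolding labelled_point_def by measurable
qed

lemma graph_set_labelled_point: "graph_set (labelled_point z) = range (labelled_point z)"
proof (intro set_eqI iffI)
  fix v assume "v \<in> range (labelled_point z)"
  then obtain x where v: "v = labelled_point z x" by blast
  then have "\<forall>n. v n \<noteq> 0" "(\<lambda>n. 0 < v n) = x"
    using labelled_point_orthant[of z x] unfolding orthant_def by blast+
  then show "v \<in> graph_set (labelled_point z)"
    unfolding graph_set_def using v by simp
qed (auto simp: graph_set_def)

lemma haar_null_labelled_graph: "haar_null (graph_set (labelled_point z))"
  by (intro haar_null_graph_set measurable_labelled_point) measurable

text \<open>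
  The labels attached to the nodes of a perfect scheme in \<open>S\<close> can be chosen so that every sequence
  of labels is read along some branch.
\<close>

lemma uncountable_labels_orthant:
  assumes "S \<in> sets borel" "uncountable S"
  obtains x where "orthant x \<subseteq> (\<lambda>z. labelled_point z x) ` S"
proof -
  obtain e :: "nat list \<Rightarrow> int list" where
    e: "\<And>s s' v m m'. length s = length s' \<Longrightarrow> seg v m = e s \<Longrightarrow> seg v m' = e s' \<Longrightarrow> s = s'" and
    branch: "\<And>y. \<exists>v\<in>S. \<forall>n. \<exists>m. seg v m = e (seg y n)"
    using perfect_scheme[OF assms] by metis
  \<comment> \<open>Node \<open>e s\<close> with \<open>length s = Suc i\<close> carries the last
    entry of \<open>s\<close> as its label at place \<open>i\<close>. Nodes of equal level are
    incompatible, so \<open>z\<close> meets only one of them and the label is unambiguous.\<close>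
  define x where "x j \<longleftrightarrow> (\<exists>(s :: nat list) i. length s = Suc i \<and> j = to_nat (e s, i, s ! i))" for j
  have x: "x (to_nat (t, i, k)) \<longleftrightarrow> (\<exists>s. length s = Suc i \<and> t = e s \<and> k = s ! i)" for t i and k :: nat
    by (auto simp: x_def)
  have "v \<in> (\<lambda>z. labelled_point z x) ` S" if v: "v \<in> orthant x" for v :: "nat \<Rightarrow> int"
  proof -
    define y where "y n = nat (\<bar>v n\<bar> - 1)" for n
    obtain z where z: "z \<in> S" "\<And>n. \<exists>m. seg z m = e (seg y n)"
      using branch[of y] by blast
    have labels: "read_labels z x i = y i" for i
    proof -
      have "(\<exists>m. x (to_nat (seg z m, i, k))) \<longleftrightarrow> k = y i" for k
      proof
        assume "\<exists>m. x (to_nat (seg z m, i, k))"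
        then obtain m s where s: "length s = Suc i" "seg z m = e s" "k = s ! i"
          unfolding x by blast
        obtain m' where "seg z m' = e (seg y (Suc i))" using z(2) by blast
        with e[OF _ s(2) this] s(1) have "s = seg y (Suc i)" by simp
        then show "k = y i" using s(3) by (simp add: nth_append)
      next
        assume k: "k = y i"
        obtain m where "seg z m = e (seg y (Suc i))" using z(2) by blast
        then show "\<exists>m. x (to_nat (seg z m, i, k))"
          unfolding x k by (intro exI[of _ m] exI[of _ "seg y (Suc i)"]) (simp add: nth_append)
      qed
      then show ?thesis
        unfolding read_labels_def by (intro Least_equality) simp_all
    qed
    have "labelled_point z x = v"
    proof
      fix i
      have "v i \<noteq> 0 \<and> (0 < v i \<longleftrightarrow> x i)"
        using v unfolding orthant_def by blast
      then show "labelled_point z x i = v i"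
        by (auto simp: labelled_point_def labels y_def)
    qed
    then show ?thesis using z(1) by blast
  qed
  then show ?thesis using that by blast
qed

text \<open>
  The set in question is coanalytic without perfect subsets; pruning writes it as a union of
  \<open>\<omega>\<^sub>1\<close> Borel sets, which are countable.
\<close>

lemma card_labelled_graphs_subset:
  assumes B: "B \<in> sets borel" and no_orthant: "\<And>x. \<not> orthant x \<subseteq> B"
  shows "|{z. graph_set (labelled_point z) \<subseteq> B}| \<le>o omega_1"
proof -
  let ?S = "{z. graph_set (labelled_point z) \<subseteq> B}"
  \<comment> \<open>A pair of \<open>z\<close> and \<open>x\<close> is coded as the single sequence
    \<open>2 * z n + of_bool (x n)\<close>, so that the projection of Borel subsets of
    \<open>nat \<Rightarrow> int\<close> applies to pairs.\<close>
  define fu where "fu u = labelled_point (\<lambda>n. u n div 2) (\<lambda>n. odd (u n))" for u :: "nat \<Rightarrow> int"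
  have "fu \<in> borel_measurable borel"
    unfolding fu_def
  proof (rule measurable_labelled_point)
    show "(\<lambda>u n. u n div 2) \<in> borel_measurable (borel :: (nat \<Rightarrow> int) measure)"
      unfolding measurable_nat_int_iff by (intro allI measurable_compose[OF measurable_coordinate]) simp
  qed measurable
  then have "fu -` (- B) \<in> sets borel"
    by (rule measurable_sets_borel) (simp add: B borel_comp)
  then obtain Q where "projects_to Q (fu -` (- B))"
    using borel_projects_to by blast
  note Q = this[unfolded projects_to_def]
  \<comment> \<open>The tree of attempts, for fixed \<open>z\<close>, to find an \<open>x\<close>
    with \<open>labelled_point z x\<close> outside \<open>B\<close>; the parameter belongs to the
    set exactly when all attempts fail.\<close>
  define T where "T z l \<longleftrightarrow> (\<forall>n\<le>length l. Q (map fst (take n l)) (map snd (take n l))) \<and>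
      (\<forall>i<length l. fst (l ! i) div 2 = z i)" for z :: "nat \<Rightarrow> int" and l :: "(int \<times> nat) list"
  have T_branch: "(\<forall>n. T z (seg b n)) \<longleftrightarrow>
      (\<forall>n. Q (seg (fst \<circ> b) n) (seg (snd \<circ> b) n)) \<and> (\<lambda>n. (fst \<circ> b) n div 2) = z" for z b
  proof
    assume *: "\<forall>n. T z (seg b n)"
    have "Q (seg (fst \<circ> b) n) (seg (snd \<circ> b) n)" "fst (b n) div 2 = z n" for n
    proof -
      have "Q (map fst (take n (seg b (Suc n)))) (map snd (take n (seg b (Suc n))))"
        "fst (seg b (Suc n) ! n) div 2 = z n"
        using *[rule_format, of "Suc n"] unfolding T_def by (simp_all del: upt_Suc)
      then show "Q (seg (fst \<circ> b) n) (seg (snd \<circ> b) n)" "fst (b n) div 2 = z n"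
        by (simp_all add: take_seg del: upt_Suc)
    qed
    then show "(\<forall>n. Q (seg (fst \<circ> b) n) (seg (snd \<circ> b) n)) \<and> (\<lambda>n. (fst \<circ> b) n div 2) = z"
      by auto
  qed (auto simp: T_def take_seg)
  have S_iff: "z \<in> ?S \<longleftrightarrow> \<not> (\<exists>b. \<forall>n. T z (seg b n))" for z
  proof -
    have "(\<exists>b. \<forall>n. T z (seg b n)) \<longleftrightarrow> (\<exists>u. fu u \<in> - B \<and> (\<lambda>n. u n div 2) = z)"
    proof
      assume "\<exists>b. \<forall>n. T z (seg b n)"
      then obtain b where b: "\<forall>n. Q (seg (fst \<circ> b) n) (seg (snd \<circ> b) n)" "(\<lambda>n. (fst \<circ> b) n div 2) = z"
        unfolding T_branch by blast
      then have "fst \<circ> b \<in> fu -` (- B)" unfolding Q by blast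
      then show "\<exists>u. fu u \<in> - B \<and> (\<lambda>n. u n div 2) = z" using b(2) by blast
    next
      assume "\<exists>u. fu u \<in> - B \<and> (\<lambda>n. u n div 2) = z"
      then obtain u where u: "u \<in> fu -` (- B)" "(\<lambda>n. u n div 2) = z" by blast
      then obtain w where "\<forall>n. Q (seg u n) (seg w n)" unfolding Q by blast
      then have "\<forall>n. T z (seg (\<lambda>i. (u i, w i)) n)"
        unfolding T_branch using u(2) by (simp add: o_def)
      then show "\<exists>b. \<forall>n. T z (seg b n)" by blast
    qed
    also have "\<dots> \<longleftrightarrow> (\<exists>x. labelled_point z x \<in> - B)"
    proof
      assume "\<exists>x. labelled_point z x \<in> - B"
      then obtain x where x: "labelled_point z x \<in> - B" by blast
      have "(\<lambda>n. (2 * z n + of_bool (x n)) div 2) = z" "(\<lambda>n. odd (2 * z n + of_bool (x n))) = x"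
        by (auto simp: fun_eq_iff)
      then show "\<exists>u. fu u \<in> - B \<and> (\<lambda>n. u n div 2) = z"
        using x by (intro exI[of _ "\<lambda>n. 2 * z n + of_bool (x n)"]) (simp add: fu_def)
    qed (auto simp: fu_def)
    finally show ?thesis
      unfolding graph_set_labelled_point by blast
  qed
  define Sp where "Sp \<xi> = {z. \<not> prune (T z) \<xi> []}" for \<xi>
  have S_eq: "?S = (\<Union>\<xi>\<in>Field omega_1. Sp \<xi>)"
  proof (rule set_eqI)
    fix z
    show "z \<in> ?S \<longleftrightarrow> z \<in> (\<Union>\<xi>\<in>Field omega_1. Sp \<xi>)"
      unfolding S_iff prune_root Sp_def by simp
  qed
  have "countable (Sp \<xi>)" if "\<xi> \<in> Field omega_1" for \<xi>
  proof (rule ccontr)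
    assume unc: "uncountable (Sp \<xi>)"
    have "Measurable.pred borel (\<lambda>z. T z t)" for t
      unfolding T_def by measurable
    then have [measurable]: "Measurable.pred borel (\<lambda>z. prune (T z) \<xi> [])"
      by (rule measurable_prune)
    have "Sp \<xi> = {z \<in> space borel. \<not> prune (T z) \<xi> []}" by (simp add: Sp_def)
    also have "\<dots> \<in> sets borel" by measurable
    \<comment> \<open>An uncountable Borel piece would, by a suitable labelling, fill a whole
      orthant with points of \<open>B\<close>.\<close>
    finally obtain x where "orthant x \<subseteq> (\<lambda>z. labelled_point z x) ` Sp \<xi>"
      using unc by (rule uncountable_labels_orthant)
    also have "\<dots> \<subseteq> B"
      using S_eq that unfolding graph_set_labelled_point by blast
    finally show False using no_orthant by blast
  qed
  then have "|Sp \<xi>| \<le>o omega_1" if "\<xi> \<in> Field omega_1" for \<xi>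
    using that countable_iff_ordLess_omega_1 ordLess_imp_ordLeq by blast
  moreover have "\<not> finite (Field omega_1)"
    using uncountable_Field_omega_1 countable_finite by blast
  moreover have "|Field omega_1| \<le>o omega_1"
    using card_of_Field_ordIso[OF Card_order_omega_1] ordIso_iff_ordLeq by blast
  ultimately show ?thesis
    unfolding S_eq using card_of_UNION_ordLeq_infinite_Field[OF _ Card_order_omega_1] by blast
qed

text \<open>The Borel members are cofinal, which gives the upper bound. A cofinal family has at
  least \<open>\<omega>\<^sub>1\<close> members, each containing at most
  \<open>\<omega>\<^sub>1\<close> labelled graphs; together they contain all of them, so the number
  of parameters \<open>z\<close> does not exceed the size of the family.\<close>

lemma cof_ideal_HN: "cof_ideal HN =o continuum"
proof -
  let ?F = "{\<A>. \<A> \<subseteq> HN \<and> (\<forall>J\<in>HN. \<exists>A\<in>\<A>. J \<subseteq> A)}"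
  have "{B \<in> HN. B \<in> sets borel} \<in> ?F"
  proof (clarsimp)
    fix J assume "J \<in> HN"
    then obtain \<mu> B where "killed_by \<mu> B" "J \<subseteq> B"
      unfolding HN_def haar_null_iff_killed by blast
    then have "haar_null B" "B \<in> sets borel"
      unfolding haar_null_iff_killed by (auto simp: killed_by_def)
    then show "\<exists>A. A \<in> HN \<and> A \<in> sets borel \<and> J \<subseteq> A"
      using \<open>J \<subseteq> B\<close> by (auto simp: HN_def)
  qed
  note borel_cofinal = this
  have "cof_ideal HN \<le>o |{B \<in> HN. B \<in> sets borel}|"
    unfolding cof_ideal_def by (rule min_card_ordLeq[OF borel_cofinal])
  also have "|{B \<in> HN. B \<in> sets borel}| \<le>o |sets (borel :: (nat \<Rightarrow> int) measure)|"
    by (rule card_of_mono1) blast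
  also have "|sets (borel :: (nat \<Rightarrow> int) measure)| \<le>o continuum" by (rule card_borel_nat_int)
  finally have "cof_ideal HN \<le>o continuum" .
  moreover have "continuum \<le>o cof_ideal HN"
    unfolding cof_ideal_def
  proof (rule ordLeq_min_card)
    show "?F \<noteq> {}" using borel_cofinal by blast
    fix \<A> assume \<A>: "\<A> \<in> ?F"
    have "\<Union>\<A> \<notin> HN"
    proof
      assume "\<Union>\<A> \<in> HN"
      moreover have "(\<Union>\<xi>\<in>Field omega_1. graph_set (leftmost_point \<xi>)) \<subseteq> \<Union>\<A>"
        using \<A> haar_null_leftmost_graph unfolding HN_def by blast
      ultimately show False
        using leftmost_graphs_not_HN haar_null_subset unfolding HN_def by blast
    qed
    then have omega_1_le: "omega_1 \<le>o |\<A>|"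
      using \<A> omega_1_ordLeq_unbounded by blast
    have "infinite \<A>"
    proof
      assume "finite \<A>"
      then have "\<Union>\<A> \<in> HN"
        using \<A> by (intro haar_null_countable_Union countable_finite) simp_all
      with \<open>\<Union>\<A> \<notin> HN\<close> show False ..
    qed
    have "|{z. graph_set (labelled_point z) \<subseteq> A}| \<le>o |\<A>|" if "A \<in> \<A>" for A
    proof -
      have "haar_null A"
        using that \<A> by (auto simp: HN_def)
      then obtain \<mu> B where B: "killed_by \<mu> B" "A \<subseteq> B"
        unfolding haar_null_iff_killed by blast
      have "|{z. graph_set (labelled_point z) \<subseteq> A}| \<le>o |{z. graph_set (labelled_point z) \<subseteq> B}|"
        using subset_trans[OF _ B(2)] by (intro card_of_mono1 Collect_mono impI)
      also have "|{z. graph_set (labelled_point z) \<subseteq> B}| \<le>o omega_1"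
        using B(1) orthant_not_subset[OF B(1)]
        by (intro card_labelled_graphs_subset) (auto simp: killed_by_def)
      also have "omega_1 \<le>o |\<A>|" by (rule omega_1_le)
      finally show ?thesis .
    qed
    then have "|\<Union>A\<in>\<A>. {z. graph_set (labelled_point z) \<subseteq> A}| \<le>o |\<A>|"
      using \<open>infinite \<A>\<close> by (intro card_of_UNION_ordLeq_infinite ballI card_of_mono1 subset_refl) auto
    moreover have "(\<Union>A\<in>\<A>. {z. graph_set (labelled_point z) \<subseteq> A}) = UNIV"
      using \<A> haar_null_labelled_graph unfolding HN_def by blast
    ultimately have "|UNIV :: (nat \<Rightarrow> int) set| \<le>o |\<A>|" by simp
    moreover have "|UNIV :: (nat \<Rightarrow> bool) set| \<le>o |UNIV :: (nat \<Rightarrow> int) set|"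
      by (rule card_of_ordLeqI[of "\<lambda>x n. of_bool (x n)"]) (auto simp: inj_on_def fun_eq_iff)
    ultimately show "continuum \<le>o |\<A>|"
      unfolding continuum_eq by (rule ordLeq_transitive[rotated])
  qed
  ultimately show ?thesis by (simp add: ordIso_iff_ordLeq)
qed

section \<open>The covering number and the uniformity\<close>

definition not_dominating :: "(nat \<Rightarrow> nat) \<Rightarrow> (nat \<Rightarrow> int) set" where
  "not_dominating f = {v. \<not> eventually_dominated f (\<lambda>n. nat \<bar>v n\<bar>)}"

text \<open>Borel-Cantelli: in a box with fast growing sides, any translate is almost surely at
  least \<open>f n\<close> in absolute value at all but finitely many coordinates.\<close>

lemma haar_null_not_dominating: "haar_null (not_dominating f)"
proof -
  have "not_dominating f = {v \<in> space borel. \<not> (\<exists>N. \<forall>n. N \<le> n \<longrightarrow> f n \<le> nat \<bar>v n\<bar>)}"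
    by (simp add: not_dominating_def eventually_dominated_def eventually_sequentially)
  also have "\<dots> \<in> sets borel" by measurable
  finally have borel: "not_dominating f \<in> sets borel" .
  \<comment> \<open>At most \<open>2 * f n\<close> integers are to be avoided at coordinate
    \<open>n\<close>, so the probability of hitting one is at most \<open>(1/2) ^ n\<close>. Adding
    one keeps the side positive when \<open>f n = 0\<close>.\<close>
  define h where "h n = 2 ^ n * (2 * f n + 1)" for n
  have h1: "h n \<ge> 1" for n by (simp add: h_def Suc_le_eq)
  let ?\<mu> = "box_measure h"
  interpret prob_space ?\<mu> by simp
  have "{v. v + c \<in> not_dominating f} \<in> null_sets ?\<mu>" for c
  proof -
    define A where "A n = {v. \<bar>v n + c n\<bar> < int (f n)}" for n
    have A_borel: "A n \<in> sets ?\<mu>" for n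
    proof -
      have "A n = {v \<in> space borel. v n \<in> {a. \<bar>a + c n\<bar> < int (f n)}}" by (simp add: A_def)
      also have "\<dots> \<in> sets borel" by measurable
      finally show ?thesis by simp
    qed
    have A_small: "measure ?\<mu> (A n) \<le> (1/2) ^ n" for n
    proof -
      let ?I = "{- int (f n) - c n..<int (f n) - c n}"
      have coord_borel: "{v. v n = a} \<in> sets ?\<mu>" for a
      proof -
        have "{v. v n = a} = {v \<in> space borel. v n = a}" by simp
        also have "\<dots> \<in> sets borel" by measurable
        finally show ?thesis by simp
      qed
      have "measure ?\<mu> (A n) \<le> measure ?\<mu> (\<Union>a\<in>?I. {v. v n = a})"
        using coord_borel by (intro finite_measure_mono sets.finite_UN) (auto simp: A_def)
      also have "\<dots> \<le> (\<Sum>a\<in>?I. measure ?\<mu> {v. v n = a})"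
        using coord_borel by (intro finite_measure_subadditive_finite) auto
      also have "\<dots> \<le> (\<Sum>a\<in>?I. 1 / real (h n))"
      proof (rule sum_mono)
        fix a
        have "ennreal (measure ?\<mu> {v. v n = a}) \<le> ennreal (1 / real (h n))"
          using emeasure_box_measure_coordinate[of h, OF h1] by (simp add: emeasure_eq_measure)
        then show "measure ?\<mu> {v. v n = a} \<le> 1 / real (h n)"
          by (simp add: ennreal_le_iff)
      qed
      also have "\<dots> = real (2 * f n) / real (h n)"
        by simp
      also have "\<dots> \<le> (1/2) ^ n"
      proof -
        have "(1/2) ^ n * real (h n) = real (2 * f n) + 1"
          by (simp add: h_def power_one_over add_divide_distrib)
        moreover have "0 < real (h n)" using h1[of n] by simp
        ultimately show ?thesis by (simp add: pos_divide_le_eq)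
      qed
      finally show ?thesis .
    qed
    have "summable (\<lambda>n. measure ?\<mu> (A n))"
      by (rule summable_comparison_test'[of "\<lambda>n. (1/2) ^ n" 0])
         (use A_small in \<open>auto simp: summable_geometric\<close>)
    then have "AE v in ?\<mu>. eventually (\<lambda>n. v \<in> space ?\<mu> - A n) sequentially"
      using A_borel by (intro borel_cantelli_AE1) (auto simp: less_top[symmetric])
    then have "AE v in ?\<mu>. v + c \<notin> not_dominating f"
    proof eventually_elim
      case (elim v)
      have "eventually_dominated f (\<lambda>n. nat \<bar>(v + c) n\<bar>)"
        unfolding eventually_dominated_def using elim
      proof eventually_elim
        case (elim n)
        then show ?case by (simp add: A_def)
      qed
      then show ?case by (simp add: not_dominating_def)
    qed
    then show ?thesis
      using translate_borel[OF borel, of c] by (simp add: AE_iff_null)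
  qed
  then have "killed_by ?\<mu> (not_dominating f)"
    unfolding killed_by_def using borel by simp
  then show ?thesis
    unfolding haar_null_iff_killed by blast
qed

section \<open>Transfer of null sets to and from the real line\<close>

definition binary_value :: "(nat \<Rightarrow> int) \<Rightarrow> real" where
  "binary_value u = (\<Sum>n. real_of_int (u n) / 2 ^ Suc n)"

lemma measurable_binary_value: "binary_value \<in> borel_measurable borel"
proof -
  have "(\<lambda>u :: nat \<Rightarrow> int. real_of_int (u n) / 2 ^ Suc n) \<in> borel_measurable borel" for n
    by (rule measurable_compose[OF measurable_coordinate]) simp
  then show ?thesis
    unfolding binary_value_def by (rule borel_measurable_suminf)
qed

text \<open>The partial sums telescope to \<open>\<lfloor>2 ^ n * r\<rfloor> / 2 ^ n\<close>, which
  tends to \<open>r\<close>.\<close>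

lemma binary_value_digits:
  assumes "r \<in> {0..<1}"
  shows "binary_value (digits (\<lambda>_. 2) r) = r"
proof -
  define a where "a n = real_of_int \<lfloor>2 ^ n * r\<rfloor> / 2 ^ n" for n
  have "real_of_int (digits (\<lambda>_. 2) r n) / 2 ^ Suc n = a (Suc n) - a n" for n
    using digits_step[of "\<lambda>_. 2" n r] by (simp add: a_def field_simps)
  moreover have "a \<longlonglongrightarrow> r"
  proof (rule tendsto_sandwich)
    have "r - (1/2) ^ n \<le> a n \<and> a n \<le> r" for n
    proof -
      have "2 ^ n * r - 1 \<le> real_of_int \<lfloor>2 ^ n * r\<rfloor>" "real_of_int \<lfloor>2 ^ n * r\<rfloor> \<le> 2 ^ n * r"
        by linarith+
      then have "(2 ^ n * r - 1) / 2 ^ n \<le> a n" "a n \<le> 2 ^ n * r / 2 ^ n"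
        unfolding a_def by (intro divide_right_mono; simp)+
      then show ?thesis by (simp add: diff_divide_distrib power_one_over)
    qed
    then show "\<forall>\<^sub>F n in sequentially. r - (1/2) ^ n \<le> a n" "\<forall>\<^sub>F n in sequentially. a n \<le> r"
      by auto
    have "(\<lambda>n. r - (1/2) ^ n) \<longlonglongrightarrow> r - 0"
      by (intro tendsto_intros) auto
    then show "(\<lambda>n. r - (1/2) ^ n) \<longlonglongrightarrow> r" by simp
  qed simp
  moreover have "a 0 = 0"
    using assms by (auto simp: a_def floor_eq_iff)
  ultimately have "(\<lambda>n. real_of_int (digits (\<lambda>_. 2) r n) / 2 ^ Suc n) sums r"
    using telescope_sums[of a r] by simp
  then show ?thesis
    unfolding binary_value_def by (rule sums_unique[symmetric])
qed

text \<open>Reduction modulo 2 is a homomorphism onto the compact group of binary sequences, so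
  translations upstairs become translations there.\<close>

definition parity_value :: "(nat \<Rightarrow> int) \<Rightarrow> real" where
  "parity_value v = binary_value (\<lambda>n. v n mod 2)"

lemma Lebesgue_null_iff: "N \<in> Lebesgue_null \<longleftrightarrow> (\<exists>N'\<in>null_sets lborel. N \<subseteq> N')"
  by (simp add: Lebesgue_null_def null_sets_completion_iff2)

text \<open>The fair coin measure is the Haar measure of the group of binary sequences. Its
  invariance under adding \<open>c\<close> modulo 2 is checked on cylinders, which suffices for null
  sets by \<open>null_sets_dominated\<close> with constant 1.\<close>

lemma haar_null_parity_vimage:
  assumes "N \<in> Lebesgue_null"
  shows "haar_null (parity_value -` N)"
proof -
  obtain N' where N': "N' \<in> null_sets lborel" "N \<subseteq> N'"
    using assms unfolding Lebesgue_null_iff by blast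
  then have N'_borel: "N' \<in> sets borel" by auto
  let ?\<mu> = "box_measure (\<lambda>_. 2)" and ?C = "binary_value -` N'"
  define par where "par c v = (\<lambda>n. (v n + c n) mod 2)" for c v :: "nat \<Rightarrow> int"
  have C_borel: "?C \<in> sets borel"
    by (rule measurable_sets_borel[OF measurable_binary_value N'_borel])
  have C_null: "?C \<in> null_sets ?\<mu>"
  proof -
    have "{0..<1} \<inter> digits (\<lambda>_. 2) -` ?C = {0..<1} \<inter> N'"
      using binary_value_digits by auto
    then show ?thesis
      unfolding null_sets_box_measure_iff[OF C_borel]
      using N'(1) by (simp add: null_set_Int1)
  qed
  have par: "par c \<in> borel_measurable borel" for c
    unfolding measurable_nat_int_iff par_def
    by (intro allI measurable_compose[OF measurable_coordinate]) simp
  then have par': "par c \<in> measurable ?\<mu> borel" for c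
    using measurable_cong_sets[OF box_measure(2) refl] by blast
  have null: "par c -` ?C \<in> null_sets ?\<mu>" for c
  proof -
    have "?C \<in> null_sets (distr ?\<mu> borel (par c))"
    proof (rule null_sets_dominated[of _ ?\<mu> 1])
      show "finite_measure (distr ?\<mu> borel (par c))" "finite_measure ?\<mu>"
        by (intro prob_space.finite_measure prob_space.prob_space_distr box_measure(1) par')+
      fix s
      have e: "emeasure (distr ?\<mu> borel (par c)) (cyl s) =
          emeasure lborel ({0..<1} \<inter> digits (\<lambda>_. 2) -` (par c -` cyl s))"
        using measurable_sets_borel[OF par cyl_borel]
        by (simp add: emeasure_distr[OF par'] emeasure_box_measure)
      show "emeasure (distr ?\<mu> borel (par c)) (cyl s) \<le> ennreal 1 * emeasure ?\<mu> (cyl s)"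
      proof (cases "\<forall>i<length s. 0 \<le> s ! i \<and> s ! i < 2")
        case False
        then obtain i where "i < length s" "\<not> (0 \<le> s ! i \<and> s ! i < 2)" by blast
        moreover have "0 \<le> (v i + c i) mod 2 \<and> (v i + c i) mod 2 < 2" for v
          by simp
        ultimately have "par c v \<notin> cyl s" for v
          unfolding mem_cyl_iff par_def by metis
        then have "par c -` cyl s = {}" by blast
        then show ?thesis unfolding e by simp
      next
        case True
        \<comment> \<open>Undoing the translation on each of the prescribed digits gives a cylinder
          of the same length, hence of the same measure.\<close>
        let ?t = "map (\<lambda>i. (s ! i - c i) mod 2) [0..<length s]"
        have "digits (\<lambda>_. 2) -` (par c -` cyl s) \<subseteq> digits (\<lambda>_. 2) -` cyl ?t"
        proof
          fix r assume r: "r \<in> digits (\<lambda>_. 2) -` (par c -` cyl s)"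
          have "digits (\<lambda>_. 2) r i = (s ! i - c i) mod 2" if "i < length s" for i
          proof -
            have "(digits (\<lambda>_. 2) r i + c i) mod 2 = s ! i"
              using r that by (simp add: mem_cyl_iff par_def)
            moreover have "0 \<le> digits (\<lambda>_. 2) r i \<and> digits (\<lambda>_. 2) r i < 2"
              using digits_bounds[of "\<lambda>_. 2" i r] by simp
            ultimately show ?thesis by presburger
          qed
          then show "r \<in> digits (\<lambda>_. 2) -` cyl ?t"
            by (simp add: mem_cyl_iff)
        qed
        then have "emeasure (distr ?\<mu> borel (par c)) (cyl s) \<le> emeasure ?\<mu> (cyl ?t)"
          unfolding e emeasure_box_measure[OF cyl_borel]
          using measurable_sets_borel[OF measurable_digits cyl_borel] by (intro emeasure_mono) auto
        also have "\<dots> \<le> ennreal (1 / (\<Prod>i<length s. 2))"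
          by (subst emeasure_box_measure_cyl) auto
        also have "\<dots> = emeasure ?\<mu> (cyl s)"
          using True by (subst emeasure_box_measure_cyl) auto
        finally show ?thesis by simp
      qed
    qed (use C_null in simp_all)
    then show ?thesis
      unfolding null_sets_distr_iff[OF par'] by simp
  qed
  have eq: "{v. v + c \<in> par 0 -` ?C} = par c -` ?C" for c
    by (auto simp: par_def)
  have "killed_by ?\<mu> (par 0 -` ?C)"
    unfolding killed_by_def eq using null measurable_sets_borel[OF par C_borel] by simp
  moreover have "parity_value -` N \<subseteq> par 0 -` ?C"
    using N'(2) by (auto simp: parity_value_def par_def)
  ultimately show ?thesis
    unfolding haar_null_iff_killed by blast
qed

text \<open>Digits are uniform only on the unit interval; \<open>frac\<close> repeats them
  periodically, and the preimage is a countable union of integer translates of a null set.\<close>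

lemma Lebesgue_null_digits_vimage:
  assumes "killed_by (box_measure h) B"
  shows "{r. digits h (frac r) \<in> B} \<in> Lebesgue_null"
proof -
  have B: "B \<in> sets borel" "{v. v + 0 \<in> B} \<in> null_sets (box_measure h)"
    using assms unfolding killed_by_def by blast+
  define N where "N = {0..<1} \<inter> digits h -` B"
  have "N \<in> null_sets lborel"
    using B by (simp add: N_def null_sets_box_measure_iff)
  then have "negligible N"
    by (simp add: negligible_iff_null_sets null_sets_completionI)
  then have "negligible ((+) (of_int k) ` N)" for k :: int
    by (rule negligible_translation)
  then have "(\<Union>k::int. (+) (of_int k) ` N) \<in> null_sets lebesgue"
    by (intro null_sets_UN) (simp add: negligible_iff_null_sets)
  moreover have "{r. digits h (frac r) \<in> B} \<subseteq> (\<Union>k::int. (+) (of_int k) ` N)"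
  proof
    fix r assume "r \<in> {r. digits h (frac r) \<in> B}"
    then have "frac r \<in> N" by (simp add: N_def frac_ge_0 frac_lt_1)
    then have "of_int \<lfloor>r\<rfloor> + frac r \<in> (\<Union>k::int. (+) (of_int k) ` N)" by blast
    then show "r \<in> (\<Union>k::int. (+) (of_int k) ` N)" by (simp add: frac_def)
  qed
  ultimately show ?thesis
    unfolding Lebesgue_null_def
    by (metis negligible_iff_null_sets negligible_subset)
qed

lemma Lebesgue_null_subset: "N \<in> Lebesgue_null \<Longrightarrow> M \<subseteq> N \<Longrightarrow> M \<in> Lebesgue_null"
  unfolding Lebesgue_null_iff by blast

section \<open>Comparison with minima and maxima of two cardinals\<close>

lemma ordIso_cminI:
  assumes "Card_order r" "Card_order s" "t \<le>o r" "t \<le>o s" "r \<le>o t \<or> s \<le>o t"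
  shows "t =o cmin r s"
proof (cases "r \<le>o s")
  case True
  with assms(5) have "r \<le>o t" using ordLeq_transitive by blast
  then have "t =o r" using assms(3) by (simp add: ordIso_iff_ordLeq)
  then show ?thesis
    using cmin_cmax(1)[OF assms(1,2) True] ordIso_symmetric ordIso_transitive by blast
next
  case False
  then have "s \<le>o r"
    using assms(1,2) ordLeq_total by (auto simp: card_order_on_def)
  with assms(5) have "s \<le>o t" using ordLeq_transitive by blast
  then have "t =o s" using assms(4) by (simp add: ordIso_iff_ordLeq)
  then show ?thesis
    using cmin_cmax(2)[OF assms(1,2) False] ordIso_symmetric ordIso_transitive by blast
qed

lemma ordIso_cmaxI:
  assumes "Card_order r" "Card_order s" "r \<le>o t" "s \<le>o t"
    "s \<le>o r \<Longrightarrow> t \<le>o r" "r \<le>o s \<Longrightarrow> t \<le>o s"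
  shows "t =o cmax r s"
proof (cases "r \<le>o s")
  case True
  then have "t =o s" using assms(4,6) by (simp add: ordIso_iff_ordLeq)
  then show ?thesis
    using cmin_cmax(3)[OF assms(1,2) True] ordIso_symmetric ordIso_transitive by blast
next
  case False
  then have "s \<le>o r"
    using assms(1,2) ordLeq_total by (auto simp: card_order_on_def)
  then have "t =o r" using assms(3,5) by (simp add: ordIso_iff_ordLeq)
  then show ?thesis
    using cmin_cmax(4)[OF assms(1,2) False] ordIso_symmetric ordIso_transitive by blast
qed

lemma bounding_family_nonempty: "{F. \<not> (\<exists>g. \<forall>f\<in>F. eventually_dominated f g)} \<noteq> {}"
proof -
  have "\<not> eventually_dominated (\<lambda>n. Suc (g n)) g" for g
    by (simp add: eventually_dominated_def)
  then have "UNIV \<in> {F. \<not> (\<exists>g. \<forall>f\<in>F. eventually_dominated f g)}" by blast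
  then show ?thesis by blast
qed

lemma haar_null_eventually_killed:
  assumes "haar_null X"
  obtains B h0 where "X \<subseteq> B"
    "\<And>h. (\<And>n. h n \<ge> 1) \<Longrightarrow> eventually_dominated h0 h \<Longrightarrow> killed_by (box_measure h) B"
  using assms killed_by_box_measure unfolding haar_null_iff_killed by metis

text \<open>Both upper bounds pull covers back, through \<open>not_dominating\<close> and
  \<open>parity_value\<close>. Conversely, given a cover, either the bounds \<open>h0\<close> of its
  members form an unbounded family, or one \<open>h\<close> serves all members and the preimages
  under \<open>digits h\<close> cover the line by null sets.\<close>

lemma cov_ideal_HN: "cov_ideal HN =o cmin bounding_number (cov_ideal Lebesgue_null)"
proof (rule ordIso_cminI)
  show "Card_order bounding_number" "Card_order (cov_ideal Lebesgue_null)"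
    by (simp_all add: bounding_number_def cov_ideal_def Card_order_min_card)
  obtain F where "F \<in> {F. \<not> (\<exists>g. \<forall>f\<in>F. eventually_dominated f g)}" "bounding_number = |F|"
    unfolding bounding_number_def by (rule min_card[OF bounding_family_nonempty])
  then have F: "\<not> (\<exists>g. \<forall>f\<in>F. eventually_dominated f g)" "bounding_number = |F|"
    by blast+
  have cover: "not_dominating ` F \<in> {\<A>. \<A> \<subseteq> HN \<and> \<Union>\<A> = UNIV}"
  proof -
    have "v \<in> \<Union>(not_dominating ` F)" for v
      using F(1) by (auto simp: not_dominating_def)
    then show ?thesis
      using haar_null_not_dominating by (auto simp: HN_def)
  qed
  have "cov_ideal HN \<le>o |not_dominating ` F|"
    unfolding cov_ideal_def by (rule min_card_ordLeq[OF cover])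
  then show "cov_ideal HN \<le>o bounding_number"
    unfolding F(2) using card_of_image ordLeq_transitive by blast
  have "{\<A>. \<A> \<subseteq> Lebesgue_null \<and> \<Union>\<A> = UNIV} \<noteq> {}"
  proof -
    have "range (\<lambda>r. {r}) \<in> {\<A>. \<A> \<subseteq> Lebesgue_null \<and> \<Union>\<A> = UNIV}"
      by (auto simp: Lebesgue_null_def)
    then show ?thesis by blast
  qed
  then show "cov_ideal HN \<le>o cov_ideal Lebesgue_null"
    unfolding cov_ideal_def[of Lebesgue_null]
  proof (rule ordLeq_min_card)
    fix \<A> assume \<A>: "\<A> \<in> {\<A>. \<A> \<subseteq> Lebesgue_null \<and> \<Union>\<A> = UNIV}"
    then have "(\<lambda>N. parity_value -` N) ` \<A> \<in> {\<A>. \<A> \<subseteq> HN \<and> \<Union>\<A> = UNIV}"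
      using haar_null_parity_vimage unfolding HN_def by blast
    then have "cov_ideal HN \<le>o |(\<lambda>N. parity_value -` N) ` \<A>|"
      unfolding cov_ideal_def by (rule min_card_ordLeq)
    then show "cov_ideal HN \<le>o |\<A>|"
      using card_of_image ordLeq_transitive by blast
  qed
  have "{\<A>. \<A> \<subseteq> HN \<and> \<Union>\<A> = UNIV} \<noteq> {}" using cover by blast
  then obtain \<H> where "\<H> \<in> {\<A>. \<A> \<subseteq> HN \<and> \<Union>\<A> = UNIV}" "cov_ideal HN = |\<H>|"
    unfolding cov_ideal_def by (rule min_card)
  then have \<H>: "\<H> \<subseteq> HN" "\<Union>\<H> = UNIV" "cov_ideal HN = |\<H>|" by simp_all
  show "bounding_number \<le>o cov_ideal HN \<or> cov_ideal Lebesgue_null \<le>o cov_ideal HN"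
  proof (rule disjCI)
    assume "\<not> cov_ideal Lebesgue_null \<le>o cov_ideal HN"
    have "\<forall>H. \<exists>B h0. H \<in> \<H> \<longrightarrow> H \<subseteq> B \<and>
      (\<forall>h. (\<forall>n. h n \<ge> 1) \<longrightarrow> eventually_dominated h0 h \<longrightarrow> killed_by (box_measure h) B)"
    proof (intro allI)
      fix H
      show "\<exists>B h0. H \<in> \<H> \<longrightarrow> H \<subseteq> B \<and>
        (\<forall>h. (\<forall>n. h n \<ge> 1) \<longrightarrow> eventually_dominated h0 h \<longrightarrow> killed_by (box_measure h) B)"
      proof (cases "H \<in> \<H>")
        case True
        then have "haar_null H" using \<H>(1) by (auto simp: HN_def)
        then show ?thesis by (rule haar_null_eventually_killed) blast
      qed simp
    qed
    then obtain B h0 where hull: "\<And>H. H \<in> \<H> \<Longrightarrow> H \<subseteq> B H" and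
      kill: "\<And>H h. H \<in> \<H> \<Longrightarrow> (\<And>n. h n \<ge> 1) \<Longrightarrow> eventually_dominated (h0 H) h \<Longrightarrow>
        killed_by (box_measure h) (B H)"
      by metis
    have "\<not> (\<exists>g. \<forall>f\<in>h0 ` \<H>. eventually_dominated f g)"
    proof
      assume "\<exists>g. \<forall>f\<in>h0 ` \<H>. eventually_dominated f g"
      then obtain g where g: "\<And>H. H \<in> \<H> \<Longrightarrow> eventually_dominated (h0 H) g" by blast
      define h where "h n = max 1 (g n)" for n
      have "eventually_dominated (h0 H) h" if "H \<in> \<H>" for H
        using g[OF that] unfolding eventually_dominated_def
        by eventually_elim (simp add: h_def)
      then have kill_h: "killed_by (box_measure h) (B H)" if "H \<in> \<H>" for H
        using that by (intro kill) (auto simp: h_def)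
      let ?N = "\<lambda>H. {r. digits h (frac r) \<in> B H}"
      have "r \<in> \<Union>(?N ` \<H>)" for r
      proof -
        obtain H where "H \<in> \<H>" "digits h (frac r) \<in> H" using \<H>(2) by blast
        then show ?thesis using hull by blast
      qed
      then have "?N ` \<H> \<in> {\<A>. \<A> \<subseteq> Lebesgue_null \<and> \<Union>\<A> = UNIV}"
        using Lebesgue_null_digits_vimage[OF kill_h] by blast
      then have "cov_ideal Lebesgue_null \<le>o |?N ` \<H>|"
        unfolding cov_ideal_def by (rule min_card_ordLeq)
      then have "cov_ideal Lebesgue_null \<le>o |\<H>|"
        using card_of_image ordLeq_transitive by blast
      with \<open>\<not> cov_ideal Lebesgue_null \<le>o cov_ideal HN\<close> \<H>(3) show False by simp
    qed
    then have "bounding_number \<le>o |h0 ` \<H>|"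
      unfolding bounding_number_def by (intro min_card_ordLeq) simp
    then show "bounding_number \<le>o cov_ideal HN"
      unfolding \<H>(3) using card_of_image ordLeq_transitive by blast
  qed
qed

text \<open>The successor of the sum of finitely many functions exceeds each of them everywhere.
  Infinity is what lets a product of two cardinals collapse to the larger one.\<close>

lemma infinite_dominating:
  assumes "\<forall>g. \<exists>f\<in>D. eventually_dominated g f"
  shows "infinite D"
proof
  assume "finite D"
  define g where "g n = Suc (\<Sum>f\<in>D. f n)" for n
  obtain f where f: "f \<in> D" "eventually_dominated g f" using assms by blast
  have "f n < g n" for n
    using member_le_sum[OF f(1) _ \<open>finite D\<close>, of "\<lambda>f. f n"] by (simp add: g_def)
  then have "\<not> eventually_dominated g f"
    by (simp add: eventually_dominated_def not_le[symmetric])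
  then show False using f(2) by simp
qed

text \<open>Dual to the covering number: absolute values of a set that is not Haar null form a
  dominating family, and its parity values are not Lebesgue null. Conversely a set that is not Haar
  null is assembled from a dominating family and a set that is not Lebesgue null.\<close>

lemma non_ideal_HN: "non_ideal HN =o cmax dominating_number (non_ideal Lebesgue_null)"
proof (rule ordIso_cmaxI)
  let ?D = "{F. \<forall>g. \<exists>f\<in>F. eventually_dominated g f}"
  show "Card_order dominating_number" "Card_order (non_ideal Lebesgue_null)"
    by (simp_all add: dominating_number_def non_ideal_def Card_order_min_card)
  have "UNIV \<in> {H. H \<notin> HN}"
    using not_haar_null_UNIV by (simp add: HN_def)
  then have HN_nonempty: "{H. H \<notin> HN} \<noteq> {}" by blast
  show "dominating_number \<le>o non_ideal HN"
    unfolding non_ideal_def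
  proof (rule ordLeq_min_card[OF HN_nonempty])
    fix H assume H: "H \<in> {H. H \<notin> HN}"
    have "(\<lambda>v n. nat \<bar>v n\<bar>) ` H \<in> ?D"
    proof (rule ccontr)
      assume "(\<lambda>v n. nat \<bar>v n\<bar>) ` H \<notin> ?D"
      then obtain g where "\<And>v. v \<in> H \<Longrightarrow> \<not> eventually_dominated g (\<lambda>n. nat \<bar>v n\<bar>)" by blast
      then have "H \<subseteq> not_dominating g" unfolding not_dominating_def by blast
      then show False
        using H haar_null_subset[OF haar_null_not_dominating] by (simp add: HN_def)
    qed
    then have "dominating_number \<le>o |(\<lambda>v n. nat \<bar>v n\<bar>) ` H|"
      unfolding dominating_number_def by (rule min_card_ordLeq)
    then show "dominating_number \<le>o |H|"
      using card_of_image ordLeq_transitive by blast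
  qed
  show "non_ideal Lebesgue_null \<le>o non_ideal HN"
    unfolding non_ideal_def[of HN]
  proof (rule ordLeq_min_card[OF HN_nonempty])
    fix H assume H: "H \<in> {H. H \<notin> HN}"
    have "parity_value ` H \<notin> Lebesgue_null"
    proof
      assume "parity_value ` H \<in> Lebesgue_null"
      then have "haar_null (parity_value -` parity_value ` H)"
        by (rule haar_null_parity_vimage)
      then have "haar_null H" by (rule haar_null_subset) blast
      then show False using H by (simp add: HN_def)
    qed
    then have "non_ideal Lebesgue_null \<le>o |parity_value ` H|"
      unfolding non_ideal_def by (intro min_card_ordLeq) simp
    then show "non_ideal Lebesgue_null \<le>o |H|"
      using card_of_image ordLeq_transitive by blast
  qed
  have "eventually_dominated g g" for g
    by (simp add: eventually_dominated_def)
  then have "?D \<noteq> {}" by blast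
  then obtain D where D: "D \<in> ?D" "dominating_number = |D|"
    unfolding dominating_number_def by (rule min_card)
  have "UNIV \<notin> Lebesgue_null"
    unfolding Lebesgue_null_def by (simp add: negligible_iff_null_sets[symmetric])
  then have "{H. H \<notin> Lebesgue_null} \<noteq> {}" by blast
  then obtain M where "M \<in> {H. H \<notin> Lebesgue_null}" "non_ideal Lebesgue_null = |M|"
    unfolding non_ideal_def by (rule min_card)
  then have M: "M \<notin> Lebesgue_null" "non_ideal Lebesgue_null = |M|" by simp_all
  have inf: "infinite D" "infinite M"
  proof -
    show "infinite D" using D(1) by (intro infinite_dominating) simp
    show "infinite M"
      using M(1) negligible_finite by (auto simp: Lebesgue_null_def negligible_iff_null_sets[symmetric])
  qed
  \<comment> \<open>All points of \<open>M\<close> are expanded in every box from \<open>D\<close>.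
    Given a Haar null candidate, some \<open>f\<close> in \<open>D\<close> dominates its
    \<open>h0\<close>, and the expansions in that one box already refute it.\<close>
  define X where "X = (\<lambda>(f, r). digits (\<lambda>n. max 1 (f n)) (frac r)) ` (D \<times> M)"
  have "X \<notin> HN"
  proof
    assume "X \<in> HN"
    then have "haar_null X" by (simp add: HN_def)
    then obtain B h0 where B: "X \<subseteq> B"
      "\<And>h. (\<And>n. h n \<ge> 1) \<Longrightarrow> eventually_dominated h0 h \<Longrightarrow> killed_by (box_measure h) B"
      by (rule haar_null_eventually_killed) blast
    obtain f where f: "f \<in> D" "eventually_dominated h0 f" using D(1) by blast
    have "eventually_dominated h0 (\<lambda>n. max 1 (f n))"
      using f(2) unfolding eventually_dominated_def by eventually_elim simp
    then have "killed_by (box_measure (\<lambda>n. max 1 (f n))) B"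
      by (intro B(2)) auto
    then have "{r. digits (\<lambda>n. max 1 (f n)) (frac r) \<in> B} \<in> Lebesgue_null"
      by (rule Lebesgue_null_digits_vimage)
    moreover have "M \<subseteq> {r. digits (\<lambda>n. max 1 (f n)) (frac r) \<in> B}"
      using B(1) f(1) by (auto simp: X_def)
    ultimately show False
      using M(1) Lebesgue_null_subset by blast
  qed
  then have "non_ideal HN \<le>o |X|"
    unfolding non_ideal_def by (intro min_card_ordLeq) simp
  moreover have "|X| \<le>o |D \<times> M|"
    unfolding X_def by (rule card_of_image)
  ultimately have le: "non_ideal HN \<le>o |D \<times> M|"
    by (rule ordLeq_transitive)
  show "non_ideal HN \<le>o dominating_number" if "non_ideal Lebesgue_null \<le>o dominating_number"
  proof -
    have "|D \<times> M| \<le>o |D|"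
      using inf(1) that unfolding D(2) M(2)
      by (intro card_of_Sigma_ordLeq_infinite ballI card_of_mono1 subset_refl)
    then show ?thesis unfolding D(2) using le ordLeq_transitive by blast
  qed
  show "non_ideal HN \<le>o non_ideal Lebesgue_null" if "dominating_number \<le>o non_ideal Lebesgue_null"
  proof -
    have "|D \<times> M| \<le>o |M|"
      using inf(2) that unfolding D(2) M(2)
      by (intro card_of_Sigma_ordLeq_infinite ballI card_of_mono1 subset_refl)
    then show ?thesis unfolding M(2) using le ordLeq_transitive by blast
  qed
qed

theorem theorem1p6:
  shows "add_ideal HN =o omega_1
    \<and> cov_ideal HN =o cmin bounding_number (cov_ideal Lebesgue_null)
    \<and> non_ideal HN =o cmax dominating_number (non_ideal Lebesgue_null)
    \<and> cof_ideal HN =o continuum"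
  using add_ideal_HN cov_ideal_HN non_ideal_HN cof_ideal_HN by blast

end
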